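(* Let $\Gamma:[0,\ell(\Gamma)]\to\mathbb{R}^3$ be a $C^2$ embedded curve parametrized by arclength. There are constants $C_1,C_2>0$ and a function $e(\alpha)=o(\alpha^{2/3})$ as $\alpha\to0^+$, all depending only on $\Gamma$, such that the following holds. Let $\Delta\subset\mathbb{R}^2$ be the closed unit disc and let $X\in H^1(\Delta^o,\mathbb{R}^3)\cap C^0(\Delta,\mathbb{R}^3)$ parametrize a minimal surface conformally and harmonically, i.e. on $\Delta^o$ $$\Delta X=0,\qquad \langle X_{x_1},X_{x_2}\rangle=0,\qquad |X_{x_1}|=|X_{x_2}|.$$ Assume that $X(\partial\Delta)$ lies in the tubular neighborhood of $\Gamma$ of radius $r_1$ and that $D(X)\le\alpha$. Then the entire surface $X(\Delta)$ lies in the tubular neighborhood of $\Gamma$ of radius $$r_2=C_1r_1+C_2\alpha^{2/3}+e(\alpha).$$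
   Context: $D(X)=\frac12\int_{\Delta^o}|X_{x_1}|^2+|X_{x_2}|^2\,dx_1\,dx_2$ is the Dirichlet energy. In the equation $\Delta X=0$ the symbol $\Delta$ is the Laplacian; elsewhere it is the closed unit disc, with interior $\Delta^o$. The tubular neighborhood of $\Gamma$ of radius $r$ is $N_r(\Gamma)=\bigcup_{t\in[0,\ell(\Gamma)]}D_r(\Gamma,t)$, where $D_r(\Gamma,t)$ is the flat disc of radius $r$ centered at $\Gamma(t)$ and orthogonal to $\Gamma'(t)$; the term is used for radii $r$ for which these discs are pairwise disjoint (so that the neighborhood is simple), and the assertion concerns radii $r_1,r_2$ of this kind. *)

theory Defs
  imports "HOL-Analysis.Analysis" "HOL-Library.Landau_Symbols"
begin

section \<open>Curves and their tubular neighborhoods\<close>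

text \<open>
  A curve is a total function on the reals of which only the values on [0, l] matter;
  derivatives at the two endpoints are one-sided. Injectivity is required on all of [0, l],
  so the curve is an embedded arc (injectivity on a compact interval together with
  unit speed makes it an embedding). For a closed curve the discs at parameters 0 and l would
  coincide, hence never be pairwise disjoint.
\<close>

definition C2_on_interval :: "(real \<Rightarrow> 'a::real_normed_vector) \<Rightarrow> real \<Rightarrow> real \<Rightarrow> bool" where
  "C2_on_interval \<Gamma> a b \<longleftrightarrow>
     (\<exists>\<Gamma>' \<Gamma>''.
        (\<forall>t\<in>{a..b}. (\<Gamma> has_vector_derivative \<Gamma>' t) (at t within {a..b})) \<and>
        (\<forall>t\<in>{a..b}. (\<Gamma>' has_vector_derivative \<Gamma>'' t) (at t within {a..b})) \<and>
        continuous_on {a..b} \<Gamma>'')"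

definition tangent :: "(real \<Rightarrow> real^3) \<Rightarrow> real \<Rightarrow> real \<Rightarrow> real^3" where
  "tangent \<Gamma> l t = vector_derivative \<Gamma> (at t within {0..l})"

definition embedded_arclength_curve :: "(real \<Rightarrow> real^3) \<Rightarrow> real \<Rightarrow> bool" where
  "embedded_arclength_curve \<Gamma> l \<longleftrightarrow>
     0 < l \<and> C2_on_interval \<Gamma> 0 l \<and> inj_on \<Gamma> {0..l} \<and> (\<forall>t\<in>{0..l}. norm (tangent \<Gamma> l t) = 1)"

definition normal_disc :: "(real \<Rightarrow> real^3) \<Rightarrow> real \<Rightarrow> real \<Rightarrow> real \<Rightarrow> (real^3) set" where
  "normal_disc \<Gamma> l r t = {p. dist p (\<Gamma> t) \<le> r \<and> (p - \<Gamma> t) \<bullet> tangent \<Gamma> l t = 0}"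

definition tubular_nbhd :: "(real \<Rightarrow> real^3) \<Rightarrow> real \<Rightarrow> real \<Rightarrow> (real^3) set" where
  "tubular_nbhd \<Gamma> l r = (\<Union>t\<in>{0..l}. normal_disc \<Gamma> l r t)"

definition simple_tube :: "(real \<Rightarrow> real^3) \<Rightarrow> real \<Rightarrow> real \<Rightarrow> bool" where
  "simple_tube \<Gamma> l r \<longleftrightarrow> disjoint_family_on (normal_disc \<Gamma> l r) {0..l}"


section \<open>Partial derivatives, harmonicity, conformality\<close>

text \<open>
  Meaningful only at points where \<open>f\<close> is (Frechet) differentiable: test functions are so
  everywhere, and the maps of the disc are required to be C2 in its interior.
\<close>

definition partial :: "'n::finite \<Rightarrow> (real^'n \<Rightarrow> 'b::real_normed_vector) \<Rightarrow> real^'n \<Rightarrow> 'b" where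
  "partial i f x = frechet_derivative f (at x) (axis i 1)"

definition C2_on_open :: "(real^'n::finite \<Rightarrow> 'b::real_normed_vector) \<Rightarrow> (real^'n) set \<Rightarrow> bool" where
  "C2_on_open f U \<longleftrightarrow>
     open U \<and> f differentiable_on U \<and> (\<forall>i. partial i f differentiable_on U) \<and>
     (\<forall>i j. continuous_on U (partial j (partial i f)))"

definition laplacian :: "(real^'n::finite \<Rightarrow> 'b::real_normed_vector) \<Rightarrow> real^'n \<Rightarrow> 'b" where
  "laplacian f x = (\<Sum>i\<in>UNIV. partial i (partial i f) x)"

definition harmonic_on :: "(real^'n::finite \<Rightarrow> 'b::real_normed_vector) \<Rightarrow> (real^'n) set \<Rightarrow> bool" where
  "harmonic_on f U \<longleftrightarrow> C2_on_open f U \<and> (\<forall>x\<in>U. laplacian f x = 0)"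

text \<open>
  As is usual for minimal surfaces, the equations allow branch points (common zeros of the
  two partial derivatives).
\<close>

definition conformal_on :: "(real^2 \<Rightarrow> real^3) \<Rightarrow> (real^2) set \<Rightarrow> bool" where
  "conformal_on X U \<longleftrightarrow>
     (\<forall>p\<in>U. partial 1 X p \<bullet> partial 2 X p = 0 \<and> norm (partial 1 X p) = norm (partial 2 X p))"


section \<open>The Sobolev space $H^1$ and the Dirichlet energy\<close>

fun iterated_partial :: "'n::finite list \<Rightarrow> (real^'n \<Rightarrow> 'b::real_normed_vector) \<Rightarrow> real^'n \<Rightarrow> 'b" where
  "iterated_partial [] f = f"
| "iterated_partial (i # is) f = partial i (iterated_partial is f)"

definition test_function :: "(real^'n::finite) set \<Rightarrow> (real^'n \<Rightarrow> real) \<Rightarrow> bool" where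
  "test_function U \<phi> \<longleftrightarrow>
     (\<forall>is. iterated_partial is \<phi> differentiable_on UNIV) \<and>
     compact (closure {x. \<phi> x \<noteq> 0}) \<and> closure {x. \<phi> x \<noteq> 0} \<subseteq> U"

definition L2_on ::
    "(real^'n::finite \<Rightarrow> 'b::{second_countable_topology,banach}) \<Rightarrow> (real^'n) set \<Rightarrow> bool" where
  "L2_on f U \<longleftrightarrow>
     set_borel_measurable lebesgue U f \<and> set_integrable lebesgue U (\<lambda>x. (norm (f x))\<^sup>2)"

definition weak_partial ::
    "'n::finite \<Rightarrow> (real^'n \<Rightarrow> 'b::{second_countable_topology,banach}) \<Rightarrow> (real^'n \<Rightarrow> 'b)
      \<Rightarrow> (real^'n) set \<Rightarrow> bool" where
  "weak_partial i f g U \<longleftrightarrow>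
     (\<forall>\<phi>. test_function U \<phi> \<longrightarrow>
        (LINT x:U|lebesgue. partial i \<phi> x *\<^sub>R f x) = - (LINT x:U|lebesgue. \<phi> x *\<^sub>R g x))"

definition H1_on ::
    "(real^'n::finite \<Rightarrow> 'b::{second_countable_topology,banach}) \<Rightarrow> (real^'n) set \<Rightarrow> bool" where
  "H1_on f U \<longleftrightarrow> L2_on f U \<and> (\<forall>i. \<exists>g. L2_on g U \<and> weak_partial i f g U)"

text \<open>
  The energy is extended-real valued, so that a bound on it never holds merely because a
  divergent integral is assigned the value 0. It uses the classical partial derivatives,
  which exist in the open disc for the harmonic maps considered and agree there almost
  everywhere with the weak ones.
\<close>

definition dirichlet_energy :: "(real^2 \<Rightarrow> real^3) \<Rightarrow> ennreal" where
  "dirichlet_energy X =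
     (1/2) * (\<integral>\<^sup>+ p \<in> ball 0 1.
        ennreal ((norm (partial 1 X p))\<^sup>2 + (norm (partial 2 X p))\<^sup>2) \<partial>lebesgue)"

end

theory Submission
  imports Defs
begin

text \<open>
  If the curve is straight, its tubes are closed and convex, and the maximum principle suffices.
  Otherwise the radii of simple tubes are bounded, so by the choice of \<open>C1\<close> and of \<open>e\<close>
  only small \<open>r1\<close> and small \<open>\<alpha>\<close> matter; then the surface even stays in the tube of radius \<open>r1\<close>.
  A monotonicity argument shows that a surface of small energy stays close to its boundary, hence
  close to the curve. There the squared distance to the curve is subharmonic on the surface,
  in the sense that it is touched from below at each point by a quadratic function with
  nonnegative Laplacian on the surface, so the distance is at most \<open>r1\<close> everywhere. Finally,
  near an end point of the curve, the height over the plane of the end disc is a harmonic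
  function, and its minimum principle keeps the surface from leaving the tube through that disc.
\<close>

section \<open>Maximum principle and integration by parts\<close>

text \<open>The distance argument is confined to a neighborhood of the curve whose size
  \<open>\<rho>\<close> depends on the curvature and on how closely the curve returns to itself; the
  energy bound is what keeps the surface from leaving it. The sharp monotonicity formula would give
  energy at least pi times the squared distance. Integrating an explicit cutoff loses a constant
  factor, which only lowers the threshold for \<alpha>, and asks for no more than integration by
  parts in one direction at a time.

  Two obstacles shape the rest. The squared distance to the curve is in general not twice
  differentiable where the nearest point reaches an end of the curve, so each maximum principle is
  applied to an explicit quadratic test function plus a small multiple of \<open>|z|^2\<close>. And
  the points at distance at most \<open>r\<close> from the curve include caps beyond the two end
  discs, which are not in the tube; a bound on the distance alone can therefore not finish the
  proof.\<close>

lemma second_derivative_nonpos_at_local_max: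
  fixes G G' :: "real \<Rightarrow> real"
  assumes "0 < d"
    and G: "\<And>s. \<bar>s\<bar> < d \<Longrightarrow> (G has_real_derivative G' s) (at s)"
    and G': "(G' has_real_derivative D) (at 0)"
    and max: "\<And>s. \<bar>s\<bar> < d \<Longrightarrow> G s \<le> G 0"
  shows "D \<le> 0"
proof (rule ccontr)
  assume "\<not> D \<le> 0"
  have "G' 0 = 0"
    using DERIV_local_max[of G "G' 0" 0 d] G[of 0] max \<open>0 < d\<close> by simp
  moreover obtain e where e: "e > 0" "\<And>h. 0 < h \<Longrightarrow> h < e \<Longrightarrow> G' 0 < G' (0 + h)"
    using DERIV_pos_inc_right[OF G'] \<open>\<not> D \<le> 0\<close> by auto
  ultimately have pos: "\<And>h. 0 < h \<Longrightarrow> h < e \<Longrightarrow> 0 < G' h"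
    by simp
  define s where "s = min d e / 2"
  have s: "0 < s" "s < d" "s < e"
    using \<open>0 < d\<close> \<open>e > 0\<close> by (auto simp: s_def)
  obtain x where x: "0 < x" "x < s" "G s - G 0 = (s - 0) * G' x"
    using MVT2[of 0 s G G'] G s by force
  then have "G s > G 0"
    using pos[of x] s by (metis diff_gt_0_iff_gt diff_zero dual_order.strict_trans mult_pos_pos)
  with max[of s] s show False by auto
qed

text \<open>Translation invariance of Lebesgue measure makes every difference quotient of
  \<open>g\<close> along \<open>e\<close> integrate to zero. By the mean value theorem on lines the
  quotients share a bound \<open>B\<close> with the derivative, and they vanish off a larger ball,
  so dominated convergence passes to the derivative. Applied to the components of a field this is
  the divergence theorem for compact support.\<close>

lemma
  fixes g :: "'a::euclidean_space \<Rightarrow> real"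
  assumes g: "\<And>x. (g has_derivative g' x) (at x)"
    and cont: "continuous_on UNIV (\<lambda>x. g' x e)"
    and supp: "\<And>x. x \<notin> cball 0 R \<Longrightarrow> g x = 0"
  shows integrable_directional_derivative: "integrable lborel (\<lambda>x. g' x e)"
    and integral_directional_derivative_eq_0: "integral\<^sup>L lborel (\<lambda>x. g' x e) = 0"
proof -
  define h where "h = (\<lambda>x. g' x e)"
  have h0: "h x = 0" if "x \<notin> cball 0 R" for x
  proof -
    have "((\<lambda>_. 0) has_derivative g' x) (at x)"
      by (rule has_derivative_transform_within_open[OF g, of "- cball 0 R"]) (use that supp in auto)
    moreover have "((\<lambda>_. 0::real) has_derivative (\<lambda>_. 0)) (at x)" by simp
    ultimately have "g' x = (\<lambda>_. 0)" by (rule has_derivative_unique)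
    then show ?thesis by (simp add: h_def)
  qed
  have h_cont: "continuous_on UNIV h"
    using cont by (simp add: h_def)
  have "integrable lborel (\<lambda>x. indicator (cball 0 R) x *\<^sub>R h x)"
    by (intro borel_integrable_compact continuous_on_subset[OF h_cont]) auto
  also have "(\<lambda>x. indicator (cball 0 R) x *\<^sub>R h x) = h"
    using h0 by (auto simp: indicator_def fun_eq_iff)
  finally show int_h: "integrable lborel (\<lambda>x. g' x e)"
    by (simp add: h_def)
  have "bounded (h ` cball 0 R)"
    by (intro compact_imp_bounded compact_continuous_image continuous_on_subset[OF h_cont]) auto
  then obtain B where B: "0 < B" "\<And>x. x \<in> cball 0 R \<Longrightarrow> \<bar>h x\<bar> \<le> B"
    by (auto simp: bounded_pos)
  then have B': "\<bar>h x\<bar> \<le> B" for x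
    using h0[of x] by (cases "x \<in> cball 0 R") auto
  have line: "((\<lambda>s. g (x + s *\<^sub>R e)) has_real_derivative h (x + s *\<^sub>R e)) (at s)" for x s
  proof -
    have "((\<lambda>s. g (x + s *\<^sub>R e)) has_derivative (\<lambda>s'. g' (x + s *\<^sub>R e) (s' *\<^sub>R e))) (at s)"
      by (rule has_derivative_compose[OF _ g]) (auto intro!: derivative_eq_intros)
    moreover have "linear (g' (x + s *\<^sub>R e))"
      using g has_derivative_linear by blast
    ultimately show ?thesis
      by (simp add: has_field_derivative_def h_def linear_scale mult_commute_abs)
  qed
  have g_cont: "continuous_on UNIV g"
    using g by (meson continuous_at_imp_continuous_on has_derivative_continuous)
  have int_g: "integrable lborel g"
  proof -
    have "integrable lborel (\<lambda>x. indicator (cball 0 R) x *\<^sub>R g x)"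
      by (intro borel_integrable_compact continuous_on_subset[OF g_cont]) auto
    also have "(\<lambda>x. indicator (cball 0 R) x *\<^sub>R g x) = g"
      using supp by (auto simp: indicator_def fun_eq_iff)
    finally show ?thesis .
  qed
  have g_meas[measurable]: "g \<in> borel_measurable borel" and h_meas[measurable]: "h \<in> borel_measurable borel"
    using g_cont h_cont by (auto intro: borel_measurable_continuous_onI)
  define q where "q = (\<lambda>n x. real (Suc n) * (g (x + (1 / real (Suc n)) *\<^sub>R e) - g x))"
  have trans: "integral\<^sup>L lborel (\<lambda>x. g (x + c)) = integral\<^sup>L lborel g \<and> integrable lborel (\<lambda>x. g (x + c))" for c
  proof -
    have "integral\<^sup>L (distr lborel borel ((+) c)) g = integral\<^sup>L lborel (\<lambda>x. g (c + x))"
      by (rule integral_distr) auto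
    moreover have "integrable (distr lborel borel ((+) c)) g = integrable lborel (\<lambda>x. g (c + x))"
      by (rule integrable_distr_eq) auto
    ultimately show ?thesis
      using int_g by (simp add: lborel_distr_plus add.commute)
  qed
  have q_int: "integral\<^sup>L lborel (q n) = 0" for n
    unfolding q_def using trans[of "(1 / real (Suc n)) *\<^sub>R e"] int_g by simp
  have q_bound: "\<bar>q n x\<bar> \<le> B * indicator (cball 0 (\<bar>R\<bar> + norm e)) x" for n x
  proof -
    define t where "t = 1 / real (Suc n)"
    have t: "0 < t" "t \<le> 1" by (auto simp: t_def)
    obtain z where "g (x + t *\<^sub>R e) - g (x + 0 *\<^sub>R e) = (t - 0) * h (x + z *\<^sub>R e)"
      using MVT2[of 0 t "\<lambda>s. g (x + s *\<^sub>R e)" "\<lambda>s. h (x + s *\<^sub>R e)"] line t by blast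
    then have "q n x = h (x + z *\<^sub>R e)"
      by (simp add: q_def t_def field_simps)
    then have 1: "\<bar>q n x\<bar> \<le> B" using B' by simp
    have 2: "q n x = 0" if "x \<notin> cball 0 (\<bar>R\<bar> + norm e)"
    proof -
      have "norm (t *\<^sub>R e) \<le> norm e"
        using t by (simp add: mult_left_le_one_le)
      moreover have "norm x \<le> norm (x + t *\<^sub>R e) + norm (t *\<^sub>R e)"
        by (metis add_diff_cancel_right' norm_triangle_ineq4)
      ultimately have "x + t *\<^sub>R e \<notin> cball 0 R" "x \<notin> cball 0 R"
        using that norm_ge_zero[of e] abs_ge_self[of R] unfolding mem_cball dist_0_norm by linarith+
      then show ?thesis using supp by (simp add: q_def t_def)
    qed
    show ?thesis using 1 2 B(1) by (auto simp: indicator_def)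
  qed
  have q_lim: "(\<lambda>n. q n x) \<longlonglongrightarrow> h x" for x
  proof -
    have "((\<lambda>s. (g (x + s *\<^sub>R e) - g x) / s) \<longlongrightarrow> h x) (at 0)"
      using line[of x 0] by (simp add: has_field_derivative_iff)
    moreover have "filterlim (\<lambda>n. 1 / real (Suc n)) (at 0) sequentially"
      unfolding filterlim_at using LIMSEQ_inverse_real_of_nat by (auto simp: inverse_eq_divide)
    ultimately have "(\<lambda>n. (g (x + (1 / real (Suc n)) *\<^sub>R e) - g x) / (1 / real (Suc n))) \<longlonglongrightarrow> h x"
      by (rule filterlim_compose)
    then show ?thesis
      by (simp add: q_def mult.commute)
  qed
  have "(\<lambda>n. integral\<^sup>L lborel (q n)) \<longlonglongrightarrow> integral\<^sup>L lborel h"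
  proof (rule integral_dominated_convergence)
    show "integrable lborel (\<lambda>x. B * indicator (cball 0 (\<bar>R\<bar> + norm e)) x :: real)"
      using borel_integrable_compact[of "cball 0 (\<bar>R\<bar> + norm e)" "\<lambda>_. B"]
      by (simp add: mult.commute)
    show "q i \<in> borel_measurable lborel" for i
      unfolding q_def by measurable
  qed (use q_bound q_lim in auto)
  then show "integral\<^sup>L lborel (\<lambda>x. g' x e) = 0"
    using q_int LIMSEQ_unique[OF _ tendsto_const] by (auto simp: h_def)
qed

text \<open>Bessel's inequality for an orthogonal pair of equal length, read off from the square of
  the part of \<open>y\<close> orthogonal to both. For the two partial derivatives of a conformal
  map it gains a factor 2 over Cauchy-Schwarz in each term; the signs in the energy estimate and in
  the distance barrier depend on this gain.\<close>

lemma inner_orthogonal_pair_le: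
  fixes a b y :: "'a::real_inner"
  assumes ab: "a \<bullet> b = 0" "norm a = norm b"
  shows "(a \<bullet> y)\<^sup>2 + (b \<bullet> y)\<^sup>2 \<le> (norm a)\<^sup>2 * (norm y)\<^sup>2"
proof (cases "a = 0")
  case False
  define L where "L = (norm a)\<^sup>2"
  define S where "S = (a \<bullet> y)\<^sup>2 + (b \<bullet> y)\<^sup>2"
  have aa: "a \<bullet> a = L" "b \<bullet> b = L"
    using ab by (auto simp: L_def power2_norm_eq_inner norm_eq)
  have "0 \<le> (L *\<^sub>R y - (a \<bullet> y) *\<^sub>R a - (b \<bullet> y) *\<^sub>R b) \<bullet> (L *\<^sub>R y - (a \<bullet> y) *\<^sub>R a - (b \<bullet> y) *\<^sub>R b)"
    by (rule inner_ge_zero)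
  also have "\<dots> = L * (L * (y \<bullet> y) - S)"
    using ab(1) by (simp add: inner_diff_left inner_diff_right aa S_def inner_commute algebra_simps power2_eq_square)
  finally have "0 \<le> L * (L * (y \<bullet> y) - S)" .
  moreover have "L > 0" using False by (simp add: L_def)
  ultimately have "S \<le> L * (y \<bullet> y)"
    by (simp add: zero_le_mult_iff)
  then show ?thesis
    by (simp add: L_def S_def power2_norm_eq_inner)
qed (use assms in auto)

lemma partial_has_vector_derivative:
  fixes f :: "real^'n::finite \<Rightarrow> 'b::real_normed_vector"
  assumes "f differentiable at (x + s *\<^sub>R axis i 1)"
  shows "((\<lambda>s. f (x + s *\<^sub>R axis i 1)) has_vector_derivative partial i f (x + s *\<^sub>R axis i 1)) (at s)"
proof -
  let ?D = "frechet_derivative f (at (x + s *\<^sub>R axis i 1))"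
  have D: "(f has_derivative ?D) (at (x + s *\<^sub>R axis i 1))"
    using assms frechet_derivative_works by blast
  have "((\<lambda>s. f (x + s *\<^sub>R axis i 1)) has_derivative (\<lambda>s'. ?D (s' *\<^sub>R axis i 1))) (at s)"
    by (rule has_derivative_compose[where f = "\<lambda>s. x + s *\<^sub>R axis i 1" and g = f and x = s and s = UNIV, OF _ D])
      (auto intro!: derivative_eq_intros)
  then show ?thesis
    using has_derivative_linear[OF D] by (simp add: has_vector_derivative_def partial_def linear_scale)
qed

text \<open>The second derivatives of \<open>X\<close> enter those of \<open>g\<close> linearly, so
  harmonicity cancels them in the Laplacian and only squares of first derivatives remain. The form
  of \<open>g\<close> covers all test functions that occur: barriers for the squared distance,
  heights over a plane, and a multiple of \<open>|y|^2\<close> alone. For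
  \<open>\<epsilon> > 0\<close> the last term has positive Laplacian, which turns the weak
  inequality at a maximum into a contradiction.\<close>

lemma laplacian_nonpos_at_local_max:
  fixes X :: "real^'n::finite \<Rightarrow> 'b::real_inner" and T c p v :: 'b and a b \<epsilon> :: real
  assumes harm: "harmonic_on X U" and "0 < d" "ball z d \<subseteq> U"
    and max: "\<And>y. y \<in> ball z d \<Longrightarrow> g y \<le> g z"
    and g: "\<And>y. g y = a * (norm (X y - c))\<^sup>2 + b * ((X y - p) \<bullet> T)\<^sup>2 + X y \<bullet> v + \<epsilon> * (norm y)\<^sup>2"
  shows "2 * a * (\<Sum>i\<in>UNIV. (norm (partial i X z))\<^sup>2) + 2 * b * (\<Sum>i\<in>UNIV. (partial i X z \<bullet> T)\<^sup>2)
           + 2 * \<epsilon> * real CARD('n) \<le> 0"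
proof -
  have "open U" using harm by (auto simp: harmonic_on_def C2_on_open_def)
  then have diff: "X differentiable at y" "partial i X differentiable at y" if "y \<in> U" for y i
    using harm that by (auto simp: harmonic_on_def C2_on_open_def differentiable_on_eq_differentiable_at)
  have "z \<in> U" using assms(2,3) by auto
  have lap: "(\<Sum>i\<in>UNIV. partial i (partial i X) z) = 0"
    using harm \<open>z \<in> U\<close> by (auto simp: harmonic_on_def laplacian_def)
  define D where "D i = 2 * a * ((norm (partial i X z))\<^sup>2 + (X z - c) \<bullet> partial i (partial i X) z)
      + 2 * b * ((partial i X z \<bullet> T)\<^sup>2 + ((X z - p) \<bullet> T) * (partial i (partial i X) z \<bullet> T))
      + partial i (partial i X) z \<bullet> v + 2 * \<epsilon>" for i
  have "D i \<le> 0" for i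
  proof (rule second_derivative_nonpos_at_local_max[OF \<open>0 < d\<close>])
    define e :: "real^'n" where "e = axis i 1"
    have in_ball: "z + s *\<^sub>R e \<in> ball z d" if "\<bar>s\<bar> < d" for s
      using that by (simp add: dist_norm e_def)
    show "g (z + s *\<^sub>R e) \<le> g (z + 0 *\<^sub>R e)" if "\<bar>s\<bar> < d" for s
      using max[OF in_ball[OF that]] by simp
    let ?X = "\<lambda>s. X (z + s *\<^sub>R e)" and ?X' = "\<lambda>s. partial i X (z + s *\<^sub>R e)"
    have e: "e \<bullet> e = 1" by (simp add: e_def inner_axis_axis)
    have X': "(?X has_vector_derivative ?X' s) (at s)" if "\<bar>s\<bar> < d" for s
      unfolding e_def using diff(1) in_ball[OF that] assms(3)
      by (intro partial_has_vector_derivative) (auto simp: e_def)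
    have X'': "(?X' has_vector_derivative partial i (partial i X) z) (at 0)"
      using partial_has_vector_derivative[of "partial i X" z 0 i] diff(2)[OF \<open>z \<in> U\<close>] by (simp add: e_def)
    show "((\<lambda>s. g (z + s *\<^sub>R e)) has_real_derivative
        2 * a * ((?X s - c) \<bullet> ?X' s) + 2 * b * (((?X s - p) \<bullet> T) * (?X' s \<bullet> T)) + ?X' s \<bullet> v
        + 2 * \<epsilon> * ((z + s *\<^sub>R e) \<bullet> e)) (at s)" if "\<bar>s\<bar> < d" for s
      unfolding g power2_norm_eq_inner unfolding power2_eq_square
      using X'[OF that]
      by (auto intro!: derivative_eq_intros simp: has_field_derivative_def has_vector_derivative_def fun_eq_iff inner_commute algebra_simps)
    show "((\<lambda>s. 2 * a * ((?X s - c) \<bullet> ?X' s) + 2 * b * (((?X s - p) \<bullet> T) * (?X' s \<bullet> T)) + ?X' s \<bullet> v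
        + 2 * \<epsilon> * ((z + s *\<^sub>R e) \<bullet> e)) has_real_derivative D i) (at 0)"
      using X'[of 0] X'' \<open>0 < d\<close> e unfolding D_def power2_norm_eq_inner
      by (auto intro!: derivative_eq_intros simp: has_field_derivative_def has_vector_derivative_def fun_eq_iff
          power2_eq_square inner_commute algebra_simps)
  qed
  then have "(\<Sum>i\<in>UNIV. D i) \<le> 0" by (simp add: sum_nonpos)
  moreover have "(\<Sum>i\<in>UNIV. D i) = 2 * a * (\<Sum>i\<in>UNIV. (norm (partial i X z))\<^sup>2)
      + 2 * b * (\<Sum>i\<in>UNIV. (partial i X z \<bullet> T)\<^sup>2) + 2 * \<epsilon> * real CARD('n)"
    using lap by (simp add: D_def sum.distrib distrib_left flip: sum_distrib_left inner_sum_left inner_sum_right)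
  ultimately show ?thesis by simp
qed

section \<open>Small energy keeps the surface near its boundary\<close>

text \<open>
  With \<open>s = |X - p|\<^sup>2\<close>, \<open>E = |\<nabla>X|\<^sup>2\<close> and \<open>G = |\<nabla>s|\<^sup>2\<close>, the right-hand side is the divergence of
  \<open>\<phi>(s) \<nabla>s\<close> for the cutoff \<open>\<phi>(s) = m\<^sup>2 / (s + \<delta>)\<close>, since \<open>\<Delta>s = 2 E\<close>.
\<close>

lemma cutoff_flux_inequality:
  fixes a \<delta> E G s :: real
  assumes "0 < a" "0 < \<delta>" "0 \<le> s" "0 \<le> E" "G \<le> 2 * E * s"
  defines "m \<equiv> max 0 (a - s)"
  shows "2 * E * (m\<^sup>2 * \<delta> / (s + \<delta>)\<^sup>2) - 4 * a * E
    \<le> (- 2 * m / (s + \<delta>) - m\<^sup>2 / (s + \<delta>)\<^sup>2) * G + m\<^sup>2 / (s + \<delta>) * (2 * E)"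
proof -
  have m: "0 \<le> m" "m \<le> a" using assms(1,3) by (auto simp: m_def)
  have sd: "0 < s + \<delta>" using assms by simp
  have "s / (s + \<delta>) \<le> 1" using sd assms by simp
  then have "m * (s / (s + \<delta>)) \<le> a * 1" using m assms by (intro mult_mono) auto
  then have 1: "4 * E * (m * s / (s + \<delta>)) \<le> 4 * a * E"
    using mult_left_mono[of "m * (s / (s + \<delta>))" a "4 * E"] assms(4) by (simp add: mult_ac)
  have "(2 * m / (s + \<delta>) + m\<^sup>2 / (s + \<delta>)\<^sup>2) * G \<le> (2 * m / (s + \<delta>) + m\<^sup>2 / (s + \<delta>)\<^sup>2) * (2 * E * s)"
    using m sd assms(5) by (intro mult_left_mono) auto
  \<comment> \<open>The two terms in \<open>m\<^sup>2\<close> combine to a multiple of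
    \<open>(s + \<delta>) - s = \<delta>\<close>; in the remaining one,
    \<open>m * s / (s + \<delta>)\<close> is at most \<open>a\<close>.\<close>
  moreover have "m\<^sup>2 / (s + \<delta>) * (2 * E) - (2 * m / (s + \<delta>) + m\<^sup>2 / (s + \<delta>)\<^sup>2) * (2 * E * s)
    = 2 * E * (m\<^sup>2 * \<delta> / (s + \<delta>)\<^sup>2) - 4 * E * (m * s / (s + \<delta>))"
    using sd by (simp add: divide_simps) (simp add: algebra_simps power2_eq_square)
  ultimately show ?thesis using 1 by (simp add: algebra_simps)
qed

text \<open>Squaring smooths the corner of the positive part at \<open>s = a\<close>. This is why
  the cutoff carries a square: its flux then extends by zero to a differentiable field on the plane
  with continuous divergence.\<close>

lemma has_real_derivative_max_0_power2:
  fixes a s :: real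
  shows "((\<lambda>s. (max 0 (a - s))\<^sup>2) has_real_derivative - 2 * max 0 (a - s)) (at s)"
proof -
  consider "s < a" | "s > a" | "s = a" by linarith
  then show ?thesis
  proof cases
    case 1
    have "((\<lambda>s. (a - s)\<^sup>2) has_real_derivative - 2 * (a - s)) (at s)"
      by (auto intro!: derivative_eq_intros)
    then have "((\<lambda>s. (max 0 (a - s))\<^sup>2) has_real_derivative - 2 * (a - s)) (at s)"
      by (rule DERIV_cong_ev[THEN iffD1, rotated 3])
        (use 1 in \<open>auto intro!: eventually_mono[OF eventually_nhds_in_open[of "{..<a}" s]]\<close>)
    then show ?thesis using 1 by simp
  next
    case 2
    have "((\<lambda>s. 0) has_real_derivative 0) (at s)" by simp
    then have "((\<lambda>s. (max 0 (a - s))\<^sup>2) has_real_derivative 0) (at s)"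
      by (rule DERIV_cong_ev[THEN iffD1, rotated 3])
        (use 2 in \<open>auto intro!: eventually_mono[OF eventually_nhds_in_open[of "{a<..}" s]]\<close>)
    then show ?thesis using 2 by simp
  next
    case 3
    have "((\<lambda>y. ((max 0 (a - y))\<^sup>2 - (max 0 (a - a))\<^sup>2) / (y - a)) \<longlongrightarrow> 0) (at a)"
    proof (rule Lim_null_comparison)
      show "((\<lambda>y. \<bar>y - a\<bar>) \<longlongrightarrow> 0) (at a)"
        by (auto intro!: tendsto_eq_intros)
      show "\<forall>\<^sub>F y in at a. norm (((max 0 (a - y))\<^sup>2 - (max 0 (a - a))\<^sup>2) / (y - a)) \<le> \<bar>y - a\<bar>"
      proof (intro always_eventually allI)
        fix y :: real
        have "(max 0 (a - y))\<^sup>2 \<le> \<bar>y - a\<bar>\<^sup>2"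
          by (intro power_mono) auto
        then have "(max 0 (a - y))\<^sup>2 \<le> \<bar>y - a\<bar> * \<bar>y - a\<bar>"
          by (simp only: power2_eq_square)
        then show "norm (((max 0 (a - y))\<^sup>2 - (max 0 (a - a))\<^sup>2) / (y - a)) \<le> \<bar>y - a\<bar>"
          by (cases "y = a") (auto simp: abs_divide divide_simps)
      qed
    qed
    then show ?thesis using 3 by (simp add: has_field_derivative_iff)
  qed
qed

lemma vector_2_eq_axis_sum: "h = h $ 1 *\<^sub>R axis 1 1 + h $ 2 *\<^sub>R (axis 2 1 :: real^2)"
  by (simp add: vec_eq_iff forall_2 axis_def)

lemma frechet_derivative_real_2:
  fixes X :: "real^2 \<Rightarrow> 'b::real_normed_vector"
  assumes "X differentiable at z"
  shows "frechet_derivative X (at z) h = h $ 1 *\<^sub>R partial 1 X z + h $ 2 *\<^sub>R partial 2 X z"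
proof -
  let ?L = "frechet_derivative X (at z)"
  have "linear ?L"
    using assms frechet_derivative_works has_derivative_linear by blast
  moreover have "?L h = ?L (h $ 1 *\<^sub>R axis 1 1 + h $ 2 *\<^sub>R axis 2 1)"
    using vector_2_eq_axis_sum[of h] by simp
  ultimately show ?thesis by (simp add: linear_add linear_scale partial_def)
qed

lemma norm_vector_2_power2: "(norm (h :: real^2))\<^sup>2 = (h $ 1)\<^sup>2 + (h $ 2)\<^sup>2"
  unfolding power2_norm_eq_inner by (simp add: inner_vec_def sum_2 power2_eq_square)

text \<open>
  The divergence of \<open>\<phi>(f) \<nabla>f\<close> with \<open>f = |X - X z0|\<^sup>2\<close> has integral zero because \<open>\<phi>(f)\<close> vanishes near
  the boundary circle. With \<open>\<delta>\<close> comparable to the values of \<open>f\<close> on a small disc around the regular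
  point \<open>z0\<close>, the positive part of this divergence has mass at least a constant on that disc,
  independently of its size.
\<close>

lemma energy_lower_bound_at_regular_point:
  fixes X :: "real^2 \<Rightarrow> real^3"
  assumes harm: "harmonic_on X (ball 0 1)" and conf: "conformal_on X (ball 0 1)"
    and cont: "continuous_on (cball 0 1) X"
    and z0: "z0 \<in> ball 0 1" "partial 1 X z0 \<noteq> 0" and "0 < \<epsilon>"
    and far: "\<And>z. z \<in> sphere 0 1 \<Longrightarrow> \<epsilon> < norm (X z - X z0)"
    and D: "dirichlet_energy X \<le> ennreal \<alpha>" "0 \<le> \<alpha>"
  shows "pi * \<epsilon>\<^sup>2 / 256 \<le> \<alpha>"
proof -
  define U :: "(real^2) set" where "U = ball 0 1"
  have U: "open U" by (simp add: U_def)
  have diff: "X differentiable at z" "partial i X differentiable at z" if "z \<in> U" for z i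
    using harm that by (auto simp: harmonic_on_def C2_on_open_def differentiable_on_eq_differentiable_at U_def)
  have cont_i: "continuous_on U X" "continuous_on U (partial i X)" "continuous_on U (partial i (partial i X))" for i
    using harm by (auto simp: harmonic_on_def C2_on_open_def U_def differentiable_imp_continuous_on)
  have lap: "partial 1 (partial 1 X) z + partial 2 (partial 2 X) z = 0" if "z \<in> U" for z
    using harm that by (auto simp: harmonic_on_def laplacian_def sum_2 U_def)
  have conf': "partial 1 X z \<bullet> partial 2 X z = 0" "norm (partial 2 X z) = norm (partial 1 X z)" if "z \<in> U" for z
    using conf that by (auto simp: conformal_on_def U_def)
  define p where "p = X z0"
  define a where "a = \<epsilon>\<^sup>2"
  have a: "0 < a" using \<open>0 < \<epsilon>\<close> by (simp add: a_def)
  define f where "f = (\<lambda>z. (norm (X z - p))\<^sup>2)"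
  define E where "E = (\<lambda>z. (norm (partial 1 X z))\<^sup>2 + (norm (partial 2 X z))\<^sup>2)"
  have E_cont: "continuous_on U E"
    unfolding E_def by (intro continuous_intros cont_i)
  have E0: "0 \<le> E z" for z by (simp add: E_def)
  define \<mu> where "\<mu> = (norm (partial 1 X z0))\<^sup>2"
  have \<mu>: "0 < \<mu>" using z0 by (simp add: \<mu>_def)
  have z0U: "z0 \<in> U" using z0 by (simp add: U_def)
  have Ez0: "E z0 = 2 * \<mu>" using conf'[OF z0U] by (simp add: E_def \<mu>_def)

  obtain d1 where d1: "0 < d1" "ball z0 d1 \<subseteq> U"
    using U z0U by (meson openE)
  have "\<forall>\<^sub>F z in nhds z0. \<mu> < E z"
    using E_cont U z0U Ez0 \<mu> by (intro order_tendstoD(1)[where y = "E z0"])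
      (auto simp: continuous_on_eq_continuous_at continuous_at tendsto_at_iff_tendsto_nhds)
  then obtain d2 where d2: "0 < d2" "\<And>z. z \<in> ball z0 d2 \<Longrightarrow> \<mu> < E z"
    by (auto simp: eventually_nhds_metric dist_commute)
  obtain d3 where d3: "0 < d3" "\<And>z. z \<in> ball z0 d3 \<Longrightarrow> norm (X z - p) \<le> 2 * sqrt \<mu> * norm (z - z0)"
  proof -
    let ?L = "frechet_derivative X (at z0)"
    have L: "(X has_derivative ?L) (at z0)"
      using diff(1)[OF z0U] frechet_derivative_works by blast
    have "norm (?L h) = sqrt \<mu> * norm h" for h
    proof -
      have "(norm (?L h))\<^sup>2 = (h $ 1)\<^sup>2 * (norm (partial 1 X z0))\<^sup>2 + (h $ 2)\<^sup>2 * (norm (partial 2 X z0))\<^sup>2"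
        using conf'(1)[OF z0U] unfolding frechet_derivative_real_2[OF diff(1)[OF z0U]] power2_norm_eq_inner
        by (simp add: inner_add_left inner_add_right inner_commute power2_eq_square)
      also have "\<dots> = \<mu> * (norm h)\<^sup>2"
        using conf'(2)[OF z0U] by (simp add: norm_vector_2_power2 \<mu>_def algebra_simps)
      also have "\<dots> = (sqrt \<mu> * norm h)\<^sup>2" using \<mu> by (simp add: power_mult_distrib)
      finally show ?thesis using \<mu> by (simp add: power2_eq_iff_nonneg)
    qed
    moreover obtain d where d: "0 < d"
      "\<And>y. norm (y - z0) < d \<Longrightarrow> norm (X y - X z0 - ?L (y - z0)) \<le> sqrt \<mu> * norm (y - z0)"
      using L \<mu> unfolding has_derivative_at_alt by (metis real_sqrt_gt_zero)
    ultimately have "norm (X z - p) \<le> 2 * sqrt \<mu> * norm (z - z0)" if "z \<in> ball z0 d" for z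
      using d(2)[of z] norm_triangle_sub[of "X z - X z0" "?L (z - z0)"] that
      by (simp add: p_def dist_norm norm_minus_commute)
    then show ?thesis using that d(1) by blast
  qed
  \<comment> \<open>The last bound on \<open>s\<close> says
    \<open>8 * \<mu> * s\<^sup>2 \<le> a\<close>. It yields \<open>\<delta> \<le> a / 2\<close>,
    where \<open>\<delta>\<close> is the square of the bound \<open>2 * sqrt \<mu> * s\<close> for
    \<open>|X - p|\<close> on the disc.\<close>
  define s where "s = min (min d1 d2) (min d3 (sqrt (a / (8 * \<mu>))))"
  have s: "0 < s" "s \<le> d1" "s \<le> d2" "s \<le> d3" "s \<le> sqrt (a / (8 * \<mu>))"
    using d1 d2 d3 a \<mu> by (auto simp: s_def)
  have s2: "8 * \<mu> * s\<^sup>2 \<le> a"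
  proof -
    have "s\<^sup>2 \<le> (sqrt (a / (8 * \<mu>)))\<^sup>2" using s by (intro power_mono) auto
    then show ?thesis using a \<mu> by (simp add: field_simps)
  qed
  define \<delta> where "\<delta> = 4 * \<mu> * s\<^sup>2"
  have \<delta>: "0 < \<delta>" "\<delta> \<le> a / 2" using \<mu> s s2 by (auto simp: \<delta>_def)
  have sub: "ball z0 s \<subseteq> U" using d1 s by auto
  have small: "\<mu> \<le> E z" "f z \<le> \<delta>" if "z \<in> ball z0 s" for z
  proof -
    show "\<mu> \<le> E z" using d2(2)[of z] that s by auto
    have "norm (X z - p) \<le> 2 * sqrt \<mu> * norm (z - z0)" using d3(2)[of z] that s by auto
    also have "\<dots> \<le> 2 * sqrt \<mu> * s"
      using that \<mu> by (intro mult_left_mono) (auto simp: dist_norm norm_minus_commute)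
    finally have "f z \<le> (2 * sqrt \<mu> * s)\<^sup>2" unfolding f_def by (intro power_mono) auto
    then show "f z \<le> \<delta>" using \<mu> by (simp add: \<delta>_def power_mult_distrib)
  qed

  define \<phi> where "\<phi> = (\<lambda>x::real. (max 0 (a - x))\<^sup>2 / (x + \<delta>))"
  define \<phi>' where "\<phi>' = (\<lambda>x::real. - 2 * max 0 (a - x) / (x + \<delta>) - (max 0 (a - x))\<^sup>2 / (x + \<delta>)\<^sup>2)"
  have \<phi>: "(\<phi> has_real_derivative \<phi>' x) (at x)" if "0 \<le> x" for x
    unfolding \<phi>_def
    by (rule has_real_derivative_max_0_power2 derivative_eq_intros refl)+
      (use that \<delta> in \<open>auto simp: \<phi>'_def power2_eq_square diff_divide_distrib\<close>)
  have f0: "0 \<le> f z" for z by (simp add: f_def)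
  have f_cont: "continuous_on U f" unfolding f_def by (intro continuous_intros cont_i)
  \<comment> \<open>Since \<open>f > a\<close> on the circle, \<open>K\<close> is a closed subset of
    the open disc. The cutoff vanishes off \<open>K\<close>, so the field below can be continued by
    zero across the circle.\<close>
  define K where "K = {z \<in> cball 0 1. f z \<le> a}"
  have f_far: "a < f z" if "z \<in> sphere 0 1" for z
    using far[OF that] \<open>0 < \<epsilon>\<close> by (simp add: a_def f_def p_def power_strict_mono)
  have "closed K"
    unfolding K_def f_def by (intro continuous_on_closed_Collect_le continuous_intros cont closed_cball)
  have KU: "K \<subseteq> U"
    using f_far by (force simp: K_def U_def order.strict_iff_order)

  \<comment> \<open>Component \<open>i\<close> of \<open>\<phi>(f)\<close> times the gradient of
    \<open>f\<close>; \<open>H' i z\<close> is its derivative at \<open>z\<close>.\<close>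
  define H where "H i z = (if z \<in> U then \<phi> (f z) * (2 * ((X z - p) \<bullet> partial i X z)) else 0)" for i z
  define H' where "H' i z h = (if z \<in> U then
      \<phi>' (f z) * (2 * ((X z - p) \<bullet> frechet_derivative X (at z) h)) * (2 * ((X z - p) \<bullet> partial i X z))
      + \<phi> (f z) * (2 * (frechet_derivative X (at z) h \<bullet> partial i X z
          + (X z - p) \<bullet> frechet_derivative (partial i X) (at z) h)) else 0)" for i z h
  have cut0: "\<phi> (f z) = 0" "\<phi>' (f z) = 0" if "z \<in> U" "z \<notin> K" for z
    using that by (auto simp: \<phi>_def \<phi>'_def K_def U_def max_def)
  have H_der: "(H i has_derivative H' i z) (at z)" for i z
  proof (cases "z \<in> U")
    case True
    let ?L = "frechet_derivative X (at z)" and ?M = "frechet_derivative (partial i X) (at z)"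
    have L: "(X has_derivative ?L) (at z)" "(partial i X has_derivative ?M) (at z)"
      using diff[OF True] frechet_derivative_works by blast+
    have f': "(f has_derivative (\<lambda>h. 2 * ((X z - p) \<bullet> ?L h))) (at z)"
      unfolding f_def power2_norm_eq_inner
      by (auto intro!: derivative_eq_intros L simp: inner_commute)
    have "((\<lambda>z. \<phi> (f z)) has_derivative (\<lambda>h. \<phi>' (f z) * (2 * ((X z - p) \<bullet> ?L h)))) (at z)"
      using has_derivative_compose[OF f', of \<phi> "(*) (\<phi>' (f z))"] \<phi>[OF f0]
      by (simp add: has_field_derivative_def)
    then have "((\<lambda>z. \<phi> (f z) * (2 * ((X z - p) \<bullet> partial i X z))) has_derivative H' i z) (at z)"
      using True by (auto intro!: derivative_eq_intros L simp: H'_def fun_eq_iff algebra_simps)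
    then show ?thesis
      by (rule has_derivative_transform_within_open[OF _ U True]) (simp add: H_def)
  next
    case False
    then have "z \<in> - K" using KU by auto
    have "((\<lambda>_. 0) has_derivative (\<lambda>_. 0::real)) (at z)" by simp
    then have "(H i has_derivative (\<lambda>_. 0)) (at z)"
      by (rule has_derivative_transform_within_open[OF _ open_Compl[OF \<open>closed K\<close>] \<open>z \<in> - K\<close>])
        (auto simp: H_def cut0)
    moreover have "H' i z = (\<lambda>_. 0)" using False by (simp add: H'_def fun_eq_iff)
    ultimately show ?thesis by simp
  qed
  have H'_axis: "H' i z (axis i 1) = \<phi>' (f z) * (2 * ((X z - p) \<bullet> partial i X z))\<^sup>2
      + \<phi> (f z) * (2 * ((norm (partial i X z))\<^sup>2 + (X z - p) \<bullet> partial i (partial i X) z))" if "z \<in> U" for i z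
    using that unfolding power2_norm_eq_inner by (simp add: H'_def power2_eq_square flip: partial_def)
  have H'_cont: "continuous_on UNIV (\<lambda>z. H' i z (axis i 1))" for i
  proof -
    have sd: "f z + \<delta> \<noteq> 0" for z using f0[of z] \<delta> by linarith
    have "continuous_on U (\<lambda>z. \<phi>' (f z) * (2 * ((X z - p) \<bullet> partial i X z))\<^sup>2
      + \<phi> (f z) * (2 * ((norm (partial i X z))\<^sup>2 + (X z - p) \<bullet> partial i (partial i X) z)))"
      unfolding \<phi>_def \<phi>'_def by (intro continuous_intros cont_i f_cont) (use sd in auto)
    then have "continuous_on U (\<lambda>z. H' i z (axis i 1))"
      by (rule continuous_on_cong[THEN iffD1, rotated 2]) (auto simp: H'_axis)
    moreover have "continuous_on (- K) (\<lambda>z. H' i z (axis i 1))"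
      by (rule continuous_on_cong[THEN iffD2, OF refl _ continuous_on_const[of _ 0]])
        (auto simp: H'_def cut0)
    ultimately have "continuous_on (U \<union> - K) (\<lambda>z. H' i z (axis i 1))"
      using U \<open>closed K\<close> by (intro continuous_on_open_Un) auto
    moreover have "U \<union> - K = UNIV" using KU by auto
    ultimately show ?thesis by simp
  qed
  have H_supp: "H i z = 0" if "z \<notin> cball 0 1" for i z
    using that by (auto simp: H_def U_def)
  define dv where "dv = (\<lambda>z. H' 1 z (axis 1 1) + H' 2 z (axis 2 1))"
  have dv: "integrable lborel dv" "integral\<^sup>L lborel dv = 0"
    unfolding dv_def
    using integrable_directional_derivative[OF H_der H'_cont H_supp]
      integral_directional_derivative_eq_0[OF H_der H'_cont H_supp] by auto

  define E1 where "E1 = (\<lambda>z. indicator U z * E z)"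
  have E1_meas: "E1 \<in> borel_measurable borel"
    unfolding E1_def using borel_measurable_continuous_on_indicator[OF _ E_cont] U by simp
  have E1_nn: "(\<integral>\<^sup>+ z. ennreal (E1 z) \<partial>lborel) \<le> ennreal (2 * \<alpha>)"
  proof -
    define N where "N = (\<integral>\<^sup>+ z. ennreal (E1 z) \<partial>lborel)"
    have "N = (\<integral>\<^sup>+ z. ennreal (E1 z) \<partial>lebesgue)"
      unfolding N_def using E1_meas by (simp add: nn_integral_completion)
    also have "\<dots> = (\<integral>\<^sup>+ z \<in> ball 0 1. ennreal (E z) \<partial>lebesgue)"
      by (intro nn_integral_cong) (auto simp: E1_def U_def indicator_def)
    finally have "dirichlet_energy X = 1 / 2 * N"
      by (simp add: dirichlet_energy_def E_def)
    then have "2 * (1 / 2 * N) \<le> 2 * ennreal \<alpha>"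
      using D by (metis mult_left_mono zero_le)
    also have "2 * (1 / 2 * N) = N"
      unfolding mult.assoc[symmetric] ennreal_times_divide by simp
    also have "2 * ennreal \<alpha> = ennreal (2 * \<alpha>)" using D by (simp add: ennreal_mult)
    finally show ?thesis by (simp add: N_def)
  qed
  have E1_0: "0 \<le> E1 z" for z by (simp add: E1_def E0)
  have E1_int: "integrable lborel E1"
  proof (rule integrableI_bounded)
    show "(\<integral>\<^sup>+ x. ennreal (norm (E1 x)) \<partial>lborel) < \<infinity>"
      using E1_nn E1_0 by (simp add: order.strict_trans1[OF _ ennreal_less_top])
  qed (use E1_meas in simp)
  have E1_le: "integral\<^sup>L lborel E1 \<le> 2 * \<alpha>"
    using E1_nn D by (intro integral_real_bounded) auto

  \<comment> \<open>On the small disc \<open>E \<ge> \<mu>\<close>, \<open>m \<ge> a / 2\<close> and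
    \<open>f + \<delta> \<le> 2 * \<delta>\<close>, so the gain is at least
    \<open>\<mu> * a\<^sup>2 / (8 * \<delta>)\<close>, which equals
    \<open>a\<^sup>2 / (32 * s\<^sup>2)\<close>.\<close>
  have pointwise: "a\<^sup>2 / (32 * s\<^sup>2) * indicator (ball z0 s) z \<le> dv z + 4 * a * E1 z" for z
  proof (cases "z \<in> U")
    case True
    define m where "m = max 0 (a - f z)"
    define G where "G = (2 * ((X z - p) \<bullet> partial 1 X z))\<^sup>2 + (2 * ((X z - p) \<bullet> partial 2 X z))\<^sup>2"
    have E: "E z = 2 * (norm (partial 1 X z))\<^sup>2" using conf'[OF True] by (simp add: E_def)
    have "(partial 1 X z \<bullet> (X z - p))\<^sup>2 + (partial 2 X z \<bullet> (X z - p))\<^sup>2 \<le> (norm (partial 1 X z))\<^sup>2 * (norm (X z - p))\<^sup>2"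
      using conf'[OF True] by (intro inner_orthogonal_pair_le) auto
    then have G: "G \<le> 2 * E z * f z"
      by (simp add: G_def E f_def inner_commute power_mult_distrib)
    have "dv z = \<phi>' (f z) * G + \<phi> (f z) * (2 * (E z + (X z - p) \<bullet> (partial 1 (partial 1 X) z + partial 2 (partial 2 X) z)))"
      by (simp add: dv_def H'_axis[OF True] G_def E_def inner_add_right algebra_simps)
    then have "dv z = (- 2 * m / (f z + \<delta>) - m\<^sup>2 / (f z + \<delta>)\<^sup>2) * G + m\<^sup>2 / (f z + \<delta>) * (2 * E z)"
      by (simp add: lap[OF True] \<phi>_def \<phi>'_def m_def)
    then have main: "2 * E z * (m\<^sup>2 * \<delta> / (f z + \<delta>)\<^sup>2) \<le> dv z + 4 * a * E1 z"
      using cutoff_flux_inequality[OF a \<delta>(1) f0 E0 G] True by (simp add: m_def E1_def)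
    show ?thesis
    proof (cases "z \<in> ball z0 s")
      case True
      note sm = small[OF True]
      have "a / 2 \<le> m" using sm(2) \<delta> by (auto simp: m_def)
      then have m2: "(a / 2)\<^sup>2 \<le> m\<^sup>2" using a by (intro power_mono) auto
      have fd: "(f z + \<delta>)\<^sup>2 \<le> (2 * \<delta>)\<^sup>2" using sm(2) f0[of z] \<delta> by (intro power_mono) auto
      have "a\<^sup>2 / (32 * s\<^sup>2) = 2 * \<mu> * ((a / 2)\<^sup>2 * \<delta> / (2 * \<delta>)\<^sup>2)"
        using s(1) \<mu> by (simp add: \<delta>_def field_simps power2_eq_square)
      also have "\<dots> \<le> 2 * E z * (m\<^sup>2 * \<delta> / (f z + \<delta>)\<^sup>2)"
        using sm \<mu> \<delta> m2 fd f0[of z]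
        by (intro mult_mono frac_le mult_right_mono) (auto simp: add_nonneg_pos)
      finally show ?thesis using main True by simp
    next
      case False
      have "0 \<le> 2 * E z * (m\<^sup>2 * \<delta> / (f z + \<delta>)\<^sup>2)" using E0 \<delta> by simp
      then show ?thesis using main False by simp
    qed
  next
    case False
    then have "z \<notin> ball z0 s" using sub by auto
    then show ?thesis using False by (simp add: dv_def H'_def E1_def)
  qed
  have ball_int: "integrable lborel (indicator (ball z0 s) :: real^2 \<Rightarrow> real)"
    using emeasure_lborel_ball_finite[of z0 s] by (simp add: integrable_indicator_iff)
  \<comment> \<open>The area \<open>pi * s\<^sup>2\<close> of the disc cancels its uncontrolled size
    and leaves \<open>pi * a\<^sup>2 / 32 \<le> 8 * a * \<alpha>\<close>, whence the constant
    256.\<close>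
  have "a\<^sup>2 / (32 * s\<^sup>2) * (s\<^sup>2 * pi) = integral\<^sup>L lborel (\<lambda>z. a\<^sup>2 / (32 * s\<^sup>2) * indicator (ball z0 s) z)"
    using s(1) content_ball[of s z0] by (simp add: unit_ball_vol_2 mult.commute)
  also have "\<dots> \<le> integral\<^sup>L lborel (\<lambda>z. dv z + 4 * a * E1 z)"
    using ball_int dv E1_int pointwise by (intro integral_mono) auto
  also have "\<dots> = 4 * a * integral\<^sup>L lborel E1"
    using dv E1_int by simp
  also have "\<dots> \<le> 4 * a * (2 * \<alpha>)" using E1_le a by (intro mult_left_mono) auto
  finally have "a * (a * pi) \<le> a * (256 * \<alpha>)"
    using s(1) by (simp add: field_simps power2_eq_square)
  then show ?thesis using a by (simp add: a_def mult.commute)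
qed

section \<open>Curves parametrized by arclength\<close>

text \<open>The C2 condition only asserts that some derivatives exist. On a nondegenerate interval
  the derivative within the interval is unique, so the first of them is
  \<open>tangent\<close>.\<close>

lemma C2_on_interval_tangent:
  assumes "embedded_arclength_curve \<Gamma> l"
  obtains \<Gamma>'' where
    "\<And>t. t \<in> {0..l} \<Longrightarrow> (\<Gamma> has_vector_derivative tangent \<Gamma> l t) (at t within {0..l})"
    "\<And>t. t \<in> {0..l} \<Longrightarrow> (tangent \<Gamma> l has_vector_derivative \<Gamma>'' t) (at t within {0..l})"
    "continuous_on {0..l} \<Gamma>''"
proof -
  from assms obtain \<Gamma>' \<Gamma>'' where d: "0 < l"
    "\<And>t. t\<in>{0..l} \<Longrightarrow> (\<Gamma> has_vector_derivative \<Gamma>' t) (at t within {0..l})"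
    "\<And>t. t\<in>{0..l} \<Longrightarrow> (\<Gamma>' has_vector_derivative \<Gamma>'' t) (at t within {0..l})"
    "continuous_on {0..l} \<Gamma>''"
    unfolding embedded_arclength_curve_def C2_on_interval_def by blast
  have eq: "tangent \<Gamma> l t = \<Gamma>' t" if "t \<in> {0..l}" for t
    unfolding tangent_def using d(1,2) that by (intro vector_derivative_within_closed_interval) auto
  show ?thesis
  proof (rule that[of \<Gamma>''])
    show "(tangent \<Gamma> l has_vector_derivative \<Gamma>'' t) (at t within {0..l})" if "t \<in> {0..l}" for t
      by (rule has_vector_derivative_transform[OF that _ d(3)[OF that]]) (simp add: eq)
  qed (use d eq in auto)
qed

text \<open>Here \<open>\<kappa>\<close> bounds the curvature and is at least \<open>1 / l\<close>,
  while \<open>\<rho>\<close> is a scale on which the curve does not come back: points less than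
  \<open>2 * \<rho>\<close> apart have parameters within \<open>1 / (16 * \<kappa>)\<close>. The
  factor 16 keeps the errors caused by bending below a sixteenth of the parameter difference, and
  \<open>1 \<le> \<kappa> * l\<close> forces the two end points to be at least
  \<open>2 * \<rho>\<close> apart.\<close>

locale arclength_bounds =
  fixes \<Gamma> :: "real \<Rightarrow> real^3" and l \<kappa> \<rho> :: real
  assumes l_pos: "0 < l" and continuous: "continuous_on {0..l} \<Gamma>" and \<kappa>_pos: "0 < \<kappa>" and \<rho>_pos: "0 < \<rho>"
    and \<kappa>\<rho>: "16 * \<kappa> * \<rho> \<le> 1" and \<kappa>l: "1 \<le> \<kappa> * l"
    and norm_tangent: "t \<in> {0..l} \<Longrightarrow> norm (tangent \<Gamma> l t) = 1"
    and tangent_lipschitz: "s \<in> {0..l} \<Longrightarrow> t \<in> {0..l} \<Longrightarrow>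
      norm (tangent \<Gamma> l t - tangent \<Gamma> l s) \<le> \<kappa> * \<bar>t - s\<bar>"
    and taylor: "s \<in> {0..l} \<Longrightarrow> t \<in> {0..l} \<Longrightarrow>
      norm (\<Gamma> t - \<Gamma> s - (t - s) *\<^sub>R tangent \<Gamma> l s) \<le> \<kappa> * (t - s)\<^sup>2"
    and chord_arc: "s \<in> {0..l} \<Longrightarrow> t \<in> {0..l} \<Longrightarrow>
      norm (\<Gamma> t - \<Gamma> s) < 2 * \<rho> \<Longrightarrow> 16 * \<kappa> * \<bar>t - s\<bar> \<le> 1"

lemma ex_arclength_bounds:
  assumes emb: "embedded_arclength_curve \<Gamma> l"
  shows "\<exists>\<kappa> \<rho>. arclength_bounds \<Gamma> l \<kappa> \<rho>"
proof -
  let ?T = "tangent \<Gamma> l"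
  obtain \<Gamma>'' where d: "\<And>t. t \<in> {0..l} \<Longrightarrow> (\<Gamma> has_vector_derivative ?T t) (at t within {0..l})"
    "\<And>t. t \<in> {0..l} \<Longrightarrow> (?T has_vector_derivative \<Gamma>'' t) (at t within {0..l})"
    "continuous_on {0..l} \<Gamma>''"
    using C2_on_interval_tangent[OF emb] by blast
  have l: "0 < l" and inj: "inj_on \<Gamma> {0..l}" and T1: "\<And>t. t \<in> {0..l} \<Longrightarrow> norm (?T t) = 1"
    using emb by (auto simp: embedded_arclength_curve_def)
  have "bounded (\<Gamma>'' ` {0..l})"
    by (intro compact_imp_bounded compact_continuous_image d) auto
  then obtain B where B: "0 < B" "\<And>t. t \<in> {0..l} \<Longrightarrow> norm (\<Gamma>'' t) \<le> B"
    by (auto simp: bounded_pos)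
  define \<kappa> where "\<kappa> = max B (1 / l)"
  have "B \<le> \<kappa>" "1 / l \<le> \<kappa>" by (auto simp: \<kappa>_def)
  then have \<kappa>: "0 < \<kappa>" "1 \<le> \<kappa> * l" "\<And>t. t \<in> {0..l} \<Longrightarrow> norm (\<Gamma>'' t) \<le> \<kappa>"
    using B l by (auto simp: field_simps intro: order_trans)
  have lip: "norm (?T t - ?T s) \<le> \<kappa> * \<bar>t - s\<bar>" if "s \<in> {0..l}" "t \<in> {0..l}" for s t
  proof -
    have "norm (?T t - ?T s) \<le> \<kappa> * norm (t - s)"
      using \<kappa>(3) that d(2)
      by (intro differentiable_bound[of "{0..l}" ?T "\<lambda>x h. h *\<^sub>R \<Gamma>'' x"])
        (auto simp: has_vector_derivative_def mult.commute[of \<kappa>] intro!: onorm_le mult_left_mono)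
    then show ?thesis by simp
  qed
  have taylor: "norm (\<Gamma> t - \<Gamma> s - (t - s) *\<^sub>R ?T s) \<le> \<kappa> * (t - s)\<^sup>2"
    if st: "s \<in> {0..l}" "t \<in> {0..l}" for s t
  proof -
    let ?I = "closed_segment s t"
    have sub: "?I \<subseteq> {0..l}"
      using st by (auto simp: closed_segment_eq_real_ivl split: if_splits)
    \<comment> \<open>Mean value inequality for the curve minus its tangent line at
      \<open>s\<close>; the derivative \<open>?T x - ?T s\<close> is controlled by the Lipschitz
      bound.\<close>
    have "norm ((\<Gamma> t - t *\<^sub>R ?T s) - (\<Gamma> s - s *\<^sub>R ?T s)) \<le> (\<kappa> * \<bar>t - s\<bar>) * norm (t - s)"
    proof (rule differentiable_bound[of ?I "\<lambda>x. \<Gamma> x - x *\<^sub>R ?T s" "\<lambda>x h. h *\<^sub>R (?T x - ?T s)"])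
      fix x assume x: "x \<in> ?I"
      then have xl: "x \<in> {0..l}" using sub by auto
      have "(\<Gamma> has_vector_derivative ?T x) (at x within ?I)"
        using d(1)[OF xl] sub by (rule has_vector_derivative_within_subset)
      then show "((\<lambda>x. \<Gamma> x - x *\<^sub>R ?T s) has_derivative (\<lambda>h. h *\<^sub>R (?T x - ?T s))) (at x within ?I)"
        unfolding has_vector_derivative_def
        by (auto intro!: derivative_eq_intros simp: algebra_simps)
      have "norm (?T x - ?T s) \<le> \<kappa> * \<bar>x - s\<bar>" using lip[OF st(1) xl] .
      also have "\<dots> \<le> \<kappa> * \<bar>t - s\<bar>"
        using x \<kappa>(1) by (auto simp: closed_segment_eq_real_ivl split: if_splits)
      finally show "onorm (\<lambda>h. h *\<^sub>R (?T x - ?T s)) \<le> \<kappa> * \<bar>t - s\<bar>"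
        by (intro onorm_le) (auto simp: mult.commute[of "\<kappa> * \<bar>t - s\<bar>"] intro!: mult_left_mono)
    qed auto
    then show ?thesis by (simp add: algebra_simps power2_eq_square abs_mult_self_eq)
  qed
  have cont: "continuous_on {0..l} \<Gamma>"
    using d(1) by (meson continuous_on_eq_continuous_within has_vector_derivative_continuous)
  \<comment> \<open>Injectivity made uniform: on the compact set of parameter pairs at least
    \<open>1 / (16 * \<kappa>)\<close> apart the chord length is positive, hence bounded below by
    some \<open>m > 0\<close>, and \<open>\<rho> \<le> m / 2\<close>.\<close>
  define K where "K = {x \<in> {0..l} \<times> {0..l}. 1 / (16 * \<kappa>) \<le> \<bar>snd x - fst x\<bar>}"
  have K: "compact K"
  proof -
    have "K = ({0..l} \<times> {0..l}) \<inter> {x. 1 / (16 * \<kappa>) \<le> \<bar>snd x - fst x\<bar>}"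
      by (auto simp: K_def)
    moreover have "closed {x::real \<times> real. 1 / (16 * \<kappa>) \<le> \<bar>snd x - fst x\<bar>}"
      by (intro closed_Collect_le continuous_intros)
    ultimately show ?thesis
      by (auto intro: compact_Int_closed compact_Times)
  qed
  obtain m where m: "0 < m" "\<And>x. x \<in> K \<Longrightarrow> m \<le> norm (\<Gamma> (snd x) - \<Gamma> (fst x))"
  proof (cases "K = {}")
    case False
    have "continuous_on K (\<lambda>x. norm (\<Gamma> (snd x) - \<Gamma> (fst x)))"
      by (intro continuous_intros continuous_on_compose2[OF cont]) (auto simp: K_def)
    from continuous_attains_inf[OF K False this] obtain x where x: "x \<in> K"
      "\<And>y. y \<in> K \<Longrightarrow> norm (\<Gamma> (snd x) - \<Gamma> (fst x)) \<le> norm (\<Gamma> (snd y) - \<Gamma> (fst y))"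
      by auto
    have "snd x \<noteq> fst x"
      using x(1) \<kappa>(1) by (auto simp: K_def)
    then have "\<Gamma> (snd x) \<noteq> \<Gamma> (fst x)"
      using inj_onD[OF inj, of "snd x" "fst x"] x(1) by (auto simp: K_def)
    then show ?thesis
      using x(2) by (intro that[of "norm (\<Gamma> (snd x) - \<Gamma> (fst x))"]) auto
  qed (use that[of 1] in auto)
  define \<rho> where "\<rho> = min (1 / (16 * \<kappa>)) (m / 2)"
  have \<rho>: "0 < \<rho>" "16 * \<kappa> * \<rho> \<le> 1"
  proof -
    show "0 < \<rho>" using m(1) \<kappa>(1) by (simp add: \<rho>_def)
    have "\<rho> \<le> 1 / (16 * \<kappa>)" by (simp add: \<rho>_def)
    then show "16 * \<kappa> * \<rho> \<le> 1" using \<kappa>(1) by (simp add: field_simps)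
  qed
  have "16 * \<kappa> * \<bar>t - s\<bar> \<le> 1" if "s \<in> {0..l}" "t \<in> {0..l}" "norm (\<Gamma> t - \<Gamma> s) < 2 * \<rho>" for s t
  proof (rule ccontr)
    assume "\<not> ?thesis"
    then have "(s, t) \<in> K" using that \<kappa>(1) by (simp add: K_def field_simps)
    with m(2)[of "(s, t)"] that(3) show False by (auto simp: \<rho>_def min_def split: if_splits)
  qed
  then have "arclength_bounds \<Gamma> l \<kappa> \<rho>"
    using l cont \<kappa> \<rho> T1 lip taylor by unfold_locales auto
  then show ?thesis by blast
qed

section \<open>Distance to the curve near a nearest point\<close>

context arclength_bounds begin

text \<open>Moving from \<open>t0\<close> towards \<open>t\<close> by the fraction
  \<open>\<theta>\<close> changes the squared distance by \<open>- 2 * \<theta> * y\<close> up to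
  order \<open>\<theta>\<^sup>2\<close>, so \<open>y > 0\<close> contradicts minimality. The
  condition is one-sided because \<open>t0\<close> may be an end point; at an interior
  \<open>t0\<close>, taken for all \<open>t\<close>, it amounts to orthogonality.\<close>

lemma nearest_point_first_order:
  assumes t0: "t0 \<in> {0..l}" and t: "t \<in> {0..l}"
    and nearest: "\<And>s. s \<in> {0..l} \<Longrightarrow> dist p (\<Gamma> t0) \<le> dist p (\<Gamma> s)"
  shows "((p - \<Gamma> t0) \<bullet> tangent \<Gamma> l t0) * (t - t0) \<le> 0"
proof (rule ccontr)
  define w \<tau> T where "w = p - \<Gamma> t0" and "\<tau> = t - t0" and "T = tangent \<Gamma> l t0"
  define y where "y = (w \<bullet> T) * \<tau>"
  assume "\<not> ?thesis"
  then have y: "y > 0" by (simp add: y_def w_def T_def \<tau>_def)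
  \<comment> \<open>\<open>C\<close> collects the coefficients of \<open>\<theta>\<^sup>2\<close>
    from \<open>|u|^2\<close> and from the Taylor remainder; \<open>\<theta>\<close> is then small
    enough for \<open>\<theta> * C < 2 * y\<close>.\<close>
  define C where "C = \<tau>\<^sup>2 * (1 + \<kappa> * \<bar>\<tau>\<bar>)\<^sup>2 + 2 * norm w * \<kappa> * \<tau>\<^sup>2"
  have "C \<ge> 0" using \<kappa>_pos by (auto simp: C_def)
  define \<theta> where "\<theta> = min 1 (y / (C + 1))"
  have \<theta>: "0 < \<theta>" "\<theta> \<le> 1" "\<theta> * C < 2 * y"
  proof -
    show "0 < \<theta>" "\<theta> \<le> 1" using y \<open>C \<ge> 0\<close> by (auto simp: \<theta>_def)
    have "\<theta> * C \<le> y / (C + 1) * C"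
      using \<open>C \<ge> 0\<close> by (intro mult_right_mono) (auto simp: \<theta>_def)
    also have "\<dots> \<le> y" using \<open>C \<ge> 0\<close> y by (simp add: field_simps)
    finally show "\<theta> * C < 2 * y" using y by simp
  qed
  define s where "s = t0 + \<theta> * \<tau>"
  have s: "s \<in> {0..l}"
  proof -
    have "s = (1 - \<theta>) *\<^sub>R t0 + \<theta> *\<^sub>R t" by (simp add: s_def \<tau>_def algebra_simps)
    then show ?thesis
      using convexD_alt[of "{0..l}" t0 t \<theta>] t0 t \<theta> by auto
  qed
  define R where "R = \<Gamma> s - \<Gamma> t0 - (\<theta> * \<tau>) *\<^sub>R T"
  have R: "norm R \<le> \<kappa> * (\<theta> * \<tau>)\<^sup>2"
    using taylor[OF t0 s] by (simp add: R_def T_def s_def)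
  define u where "u = \<Gamma> s - \<Gamma> t0"
  have u: "u = (\<theta> * \<tau>) *\<^sub>R T + R" by (simp add: R_def u_def)
  have "norm u \<le> \<theta> * \<bar>\<tau>\<bar> * norm T + norm R"
    unfolding u using norm_triangle_ineq[of "(\<theta> * \<tau>) *\<^sub>R T" R] \<theta> by (simp add: abs_mult)
  also have "\<dots> \<le> \<theta> * \<bar>\<tau>\<bar> + \<kappa> * (\<theta> * \<tau>)\<^sup>2"
    using R norm_tangent[OF t0] by (simp add: T_def)
  also have "\<kappa> * (\<theta> * \<tau>)\<^sup>2 = \<theta> * (\<theta> * (\<kappa> * \<tau>\<^sup>2))"
    by (simp add: power2_eq_square)
  also have "\<dots> \<le> \<theta> * (1 * (\<kappa> * \<tau>\<^sup>2))"
    using \<theta> \<kappa>_pos by (intro mult_left_mono mult_right_mono) auto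
  finally have "norm u \<le> \<theta> * (\<bar>\<tau>\<bar> * (1 + \<kappa> * \<bar>\<tau>\<bar>))"
    by (simp add: algebra_simps power2_eq_square abs_mult_self_eq)
  then have "(norm u)\<^sup>2 \<le> (\<theta> * (\<bar>\<tau>\<bar> * (1 + \<kappa> * \<bar>\<tau>\<bar>)))\<^sup>2"
    by (intro power_mono) auto
  then have u2: "(norm u)\<^sup>2 \<le> \<theta>\<^sup>2 * (\<tau>\<^sup>2 * (1 + \<kappa> * \<bar>\<tau>\<bar>)\<^sup>2)"
    by (simp add: power_mult_distrib)
  have "\<bar>w \<bullet> R\<bar> \<le> norm w * norm R" by (rule Cauchy_Schwarz_ineq2)
  also have "\<dots> \<le> norm w * (\<kappa> * (\<theta> * \<tau>)\<^sup>2)" using R by (intro mult_left_mono) auto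
  finally have wR: "2 * (w \<bullet> R) \<ge> - \<theta>\<^sup>2 * (2 * norm w * \<kappa> * \<tau>\<^sup>2)"
    by (simp add: power_mult_distrib algebra_simps)
  have "norm w \<le> norm (w - u)"
    using nearest[OF s] by (simp add: w_def u_def dist_norm)
  then have "(norm w)\<^sup>2 \<le> (norm (w - u))\<^sup>2" by (intro power_mono) auto
  then have "2 * (w \<bullet> u) \<le> (norm u)\<^sup>2"
    by (simp add: power2_norm_eq_inner algebra_simps inner_commute)
  moreover have "w \<bullet> u = \<theta> * y + w \<bullet> R"
    by (simp add: u y_def algebra_simps)
  ultimately have "2 * \<theta> * y \<le> \<theta>\<^sup>2 * C"
    using u2 wR by (simp add: C_def algebra_simps)
  then have "\<theta> * (2 * y) \<le> \<theta> * (\<theta> * C)"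
    by (simp add: power2_eq_square algebra_simps)
  then show False using \<theta> by (simp add: mult_le_cancel_left)
qed

text \<open>
  The barrier on the left equals the squared distance to the curve at \<open>q = p\<close>. Its Hessian has
  trace at least \<open>4 - 8/3 > 0\<close> on every plane, so it is subharmonic on minimal surfaces.
\<close>

lemma squared_distance_lower_barrier:
  assumes t0: "t0 \<in> {0..l}" and t: "t \<in> {0..l}"
    and first_order: "((p - \<Gamma> t0) \<bullet> tangent \<Gamma> l t0) * (t - t0) \<le> 0"
    and near: "norm (q - \<Gamma> t0) \<le> \<rho>"
  shows "(norm (q - \<Gamma> t0))\<^sup>2 - 4/3 * ((q - p) \<bullet> tangent \<Gamma> l t0)\<^sup>2 \<le> (norm (q - \<Gamma> t))\<^sup>2"
proof (cases "norm (\<Gamma> t - \<Gamma> t0) < 2 * \<rho>")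
  case False
  have "2 * \<rho> \<le> norm (q - \<Gamma> t0) + norm (q - \<Gamma> t)"
    using False norm_triangle_ineq4[of "q - \<Gamma> t0" "q - \<Gamma> t"] by simp
  then have "norm (q - \<Gamma> t0) \<le> norm (q - \<Gamma> t)" using near by simp
  then have "(norm (q - \<Gamma> t0))\<^sup>2 \<le> (norm (q - \<Gamma> t))\<^sup>2" by (intro power_mono) auto
  moreover have "0 \<le> 4/3 * ((q - p) \<bullet> tangent \<Gamma> l t0)\<^sup>2" by simp
  ultimately show ?thesis by linarith
next
  case True
  define D \<tau> T where "D = q - \<Gamma> t0" and "\<tau> = t - t0" and "T = tangent \<Gamma> l t0"
  define x where "x = (q - p) \<bullet> T"
  define u where "u = \<Gamma> t - \<Gamma> t0"
  define R where "R = u - \<tau> *\<^sub>R T"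
  have R: "norm R \<le> \<kappa> * \<tau>\<^sup>2" using taylor[OF t0 t] by (simp add: R_def T_def u_def \<tau>_def)
  have \<tau>: "16 * \<kappa> * \<bar>\<tau>\<bar> \<le> 1" using chord_arc[OF t0 t True] by (simp add: \<tau>_def)
  have \<kappa>\<tau>: "\<kappa> * \<tau>\<^sup>2 \<le> \<bar>\<tau>\<bar> / 16"
    using mult_right_mono[OF \<tau>, of "\<bar>\<tau>\<bar>"] by (simp add: power2_eq_square abs_mult_self_eq mult.assoc)
  have "norm (\<tau> *\<^sub>R T) \<le> norm u + norm R"
    using norm_triangle_ineq4[of u R] by (simp add: R_def)
  then have "15/16 * \<bar>\<tau>\<bar> \<le> norm u"
    using R \<kappa>\<tau> norm_tangent[OF t0] by (simp add: T_def)
  then have "(15/16 * \<bar>\<tau>\<bar>)\<^sup>2 \<le> (norm u)\<^sup>2" by (intro power_mono) auto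
  then have u2: "225/256 * \<tau>\<^sup>2 \<le> (norm u)\<^sup>2" by (simp add: power_mult_distrib power_divide)
  have "\<bar>D \<bullet> R\<bar> \<le> norm D * norm R" by (rule Cauchy_Schwarz_ineq2)
  also have "\<dots> \<le> \<rho> * (\<kappa> * \<tau>\<^sup>2)"
    using near R \<rho>_pos by (intro mult_mono) (auto simp: D_def)
  also have "\<dots> \<le> \<tau>\<^sup>2 / 16"
    using mult_right_mono[OF \<kappa>\<rho>, of "\<tau>\<^sup>2"] by (simp add: algebra_simps)
  finally have DR: "D \<bullet> R \<le> \<tau>\<^sup>2 / 16" by simp
  have "D \<bullet> u = \<tau> * (D \<bullet> T) + D \<bullet> R" by (simp add: R_def algebra_simps)
  also have "D \<bullet> T = (p - \<Gamma> t0) \<bullet> T + x" by (simp add: D_def x_def algebra_simps)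
  \<comment> \<open>The first order condition at \<open>p\<close> disposes of the part of the linear
    term that is not due to \<open>q - p\<close>.\<close>
  also have "\<tau> * ((p - \<Gamma> t0) \<bullet> T + x) \<le> \<tau> * x"
    using first_order by (simp add: T_def \<tau>_def algebra_simps)
  finally have "D \<bullet> u \<le> \<tau> * x + \<tau>\<^sup>2 / 16" using DR by simp
  moreover have "(norm (q - \<Gamma> t))\<^sup>2 = (norm D)\<^sup>2 - 2 * (D \<bullet> u) + (norm u)\<^sup>2"
    by (simp add: D_def u_def power2_norm_eq_inner algebra_simps inner_commute)
  \<comment> \<open>The coefficient of \<open>\<tau>\<^sup>2\<close> is
    \<open>225/256 - 2/16 = 193/256\<close>, which is at least \<open>3/4\<close>. Minimizing
    \<open>3/4 * \<tau>\<^sup>2 - 2 * \<tau> * x\<close> over \<open>\<tau>\<close> gives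
    \<open>- 4/3 * x\<^sup>2\<close>, the origin of the factor \<open>4/3\<close>.\<close>
  moreover have "0 \<le> 3/4 * (\<tau> - 4/3 * x)\<^sup>2" by simp
  then have "0 \<le> 3/4 * \<tau>\<^sup>2 - 2 * (\<tau> * x) + 4/3 * x\<^sup>2"
    by (simp add: power2_eq_square algebra_simps)
  ultimately have "(norm D)\<^sup>2 - 4/3 * x\<^sup>2 \<le> (norm (q - \<Gamma> t))\<^sup>2"
    using u2 zero_le_power2[of \<tau>] by linarith
  then show ?thesis by (simp add: D_def x_def T_def)
qed

text \<open>Over the plane normal to the curve at \<open>\<Gamma> t0\<close>, a point of the normal
  disc at \<open>t\<close> has height \<open>t - t0\<close> up to two errors, from the bending of
  the curve and from the tilt of the disc. Each is at most a sixteenth of \<open>|t - t0|\<close>,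
  so the point lies on the side towards \<open>t\<close>. If \<open>t0\<close> is an end point, one
  sign \<open>\<sigma>\<close> serves all \<open>t\<close>.\<close>

lemma inner_tangent_end_nonneg:
  assumes t0: "t0 \<in> {0..l}" and t: "t \<in> {0..l}" and \<sigma>: "\<bar>\<sigma>\<bar> = 1" "0 \<le> \<sigma> * (t - t0)"
    and n: "(p - \<Gamma> t) \<bullet> tangent \<Gamma> l t = 0" "norm (p - \<Gamma> t) \<le> \<rho>"
    and near: "norm (p - \<Gamma> t0) < \<rho>"
  shows "0 \<le> \<sigma> * ((p - \<Gamma> t0) \<bullet> tangent \<Gamma> l t0)"
proof -
  define \<tau> T where "\<tau> = t - t0" and "T = tangent \<Gamma> l t0"
  define u where "u = \<Gamma> t - \<Gamma> t0"
  define R where "R = u - \<tau> *\<^sub>R T"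
  have R: "norm R \<le> \<kappa> * \<tau>\<^sup>2" using taylor[OF t0 t] by (simp add: R_def T_def u_def \<tau>_def)
  have "norm (\<Gamma> t - \<Gamma> t0) < 2 * \<rho>"
    using norm_triangle_ineq4[of "p - \<Gamma> t0" "p - \<Gamma> t"] n near by simp
  then have \<tau>: "16 * \<kappa> * \<bar>\<tau>\<bar> \<le> 1" using chord_arc[OF t0 t] by (simp add: \<tau>_def)
  have \<kappa>\<tau>: "\<kappa> * \<tau>\<^sup>2 \<le> \<bar>\<tau>\<bar> / 16"
    using mult_right_mono[OF \<tau>, of "\<bar>\<tau>\<bar>"] by (simp add: power2_eq_square abs_mult_self_eq mult.assoc)
  have T1: "norm T = 1" using norm_tangent[OF t0] by (simp add: T_def)
  have "\<bar>R \<bullet> T\<bar> \<le> norm R * norm T" by (rule Cauchy_Schwarz_ineq2)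
  then have RT: "\<bar>R \<bullet> T\<bar> \<le> \<bar>\<tau>\<bar> / 16" using R \<kappa>\<tau> T1 by simp
  have "\<bar>(p - \<Gamma> t) \<bullet> (T - tangent \<Gamma> l t)\<bar> \<le> norm (p - \<Gamma> t) * norm (T - tangent \<Gamma> l t)"
    by (rule Cauchy_Schwarz_ineq2)
  also have "\<dots> \<le> \<rho> * (\<kappa> * \<bar>\<tau>\<bar>)"
    using n tangent_lipschitz[OF t0 t] \<rho>_pos
    by (intro mult_mono) (auto simp: T_def \<tau>_def norm_minus_commute)
  also have "\<dots> \<le> \<bar>\<tau>\<bar> / 16"
    using mult_right_mono[OF \<kappa>\<rho>, of "\<bar>\<tau>\<bar>"] by (simp add: algebra_simps)
  finally have nT: "\<bar>(p - \<Gamma> t) \<bullet> T\<bar> \<le> \<bar>\<tau>\<bar> / 16" using n by (simp add: inner_diff_right)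
  have "(p - \<Gamma> t0) \<bullet> T = \<tau> + R \<bullet> T + (p - \<Gamma> t) \<bullet> T"
    using T1 by (simp add: R_def u_def algebra_simps norm_eq_1)
  then have "\<sigma> * ((p - \<Gamma> t0) \<bullet> T) = \<sigma> * \<tau> + \<sigma> * (R \<bullet> T + (p - \<Gamma> t) \<bullet> T)"
    by (simp add: algebra_simps)
  moreover have "\<sigma> * \<tau> = \<bar>\<tau>\<bar>"
    using \<sigma> by (metis \<tau>_def abs_mult abs_of_nonneg mult_1)
  moreover have "\<bar>\<sigma> * (R \<bullet> T + (p - \<Gamma> t) \<bullet> T)\<bar> \<le> \<bar>\<tau>\<bar> / 8"
    unfolding abs_mult \<sigma>(1) mult_1_left
    using RT nT abs_triangle_ineq[of "R \<bullet> T" "(p - \<Gamma> t) \<bullet> T"] by linarith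
  ultimately show ?thesis unfolding T_def by linarith
qed

end

text \<open>Two normal planes that are not parallel meet, and discs that reach a common point are
  not disjoint. The point \<open>p\<close> is taken in the span of the two tangents; its
  coefficients solve a linear system with determinant \<open>1 - c\<^sup>2\<close>.\<close>

lemma not_simple_tube_if_not_parallel:
  assumes st: "s \<in> {0..l}" "t \<in> {0..l}" and "norm (tangent \<Gamma> l s) = 1" "norm (tangent \<Gamma> l t) = 1"
    and c: "\<bar>tangent \<Gamma> l s \<bullet> tangent \<Gamma> l t\<bar> < 1"
  obtains R where "0 < R" "\<And>r. R \<le> r \<Longrightarrow> \<not> simple_tube \<Gamma> l r"
proof -
  define S T where "S = tangent \<Gamma> l s" and "T = tangent \<Gamma> l t"
  define c where "c = S \<bullet> T"
  define A B where "A = \<Gamma> s \<bullet> S" and "B = \<Gamma> t \<bullet> T"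
  have ST: "S \<bullet> S = 1" "T \<bullet> T = 1" "T \<bullet> S = c" "S \<bullet> T = c"
    using assms by (auto simp: S_def T_def c_def inner_commute norm_eq_1)
  have "c\<^sup>2 < 1" using c by (simp add: c_def S_def T_def abs_square_less_1)
  then have c2: "1 - c\<^sup>2 \<noteq> 0" by simp
  define p where "p = ((A - c * B) / (1 - c\<^sup>2)) *\<^sub>R S + ((B - c * A) / (1 - c\<^sup>2)) *\<^sub>R T"
  have "p \<bullet> S = ((A - c * B) + (B - c * A) * c) / (1 - c\<^sup>2)"
    by (simp add: p_def inner_add_left ST add_divide_distrib)
  also have "(A - c * B) + (B - c * A) * c = A * (1 - c\<^sup>2)" by (simp add: algebra_simps power2_eq_square)
  finally have pS: "p \<bullet> S = A" using c2 by simp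
  have "p \<bullet> T = ((A - c * B) * c + (B - c * A)) / (1 - c\<^sup>2)"
    by (simp add: p_def inner_add_left ST add_divide_distrib)
  also have "(A - c * B) * c + (B - c * A) = B * (1 - c\<^sup>2)" by (simp add: algebra_simps power2_eq_square)
  finally have pT: "p \<bullet> T = B" using c2 by simp
  define R where "R = 1 + dist p (\<Gamma> s) + dist p (\<Gamma> t)"
  show ?thesis
  proof (rule that[of R])
    show "0 < R" by (simp add: R_def add_pos_nonneg)
    fix r assume "R \<le> r"
    then have "dist p (\<Gamma> s) \<le> r" "dist p (\<Gamma> t) \<le> r"
      using zero_le_dist[of p "\<Gamma> s"] zero_le_dist[of p "\<Gamma> t"] unfolding R_def by linarith+
    then have "p \<in> normal_disc \<Gamma> l r s \<inter> normal_disc \<Gamma> l r t"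
      using pS pT by (auto simp: normal_disc_def inner_diff_left S_def T_def A_def B_def)
    moreover have "s \<noteq> t"
      using c assms(3) by (auto simp: dot_square_norm)
    ultimately show "\<not> simple_tube \<Gamma> l r"
      using st unfolding simple_tube_def disjoint_family_on_def by blast
  qed
qed

lemma straight_or_tube_radii_bounded:
  assumes emb: "embedded_arclength_curve \<Gamma> l"
  obtains (straight) "\<And>t. t \<in> {0..l} \<Longrightarrow> tangent \<Gamma> l t = tangent \<Gamma> l 0"
  | (bounded) R where "0 < R" "\<And>r. R \<le> r \<Longrightarrow> \<not> simple_tube \<Gamma> l r"
proof (cases "\<forall>t\<in>{0..l}. tangent \<Gamma> l t = tangent \<Gamma> l 0")
  case False
  then obtain t where t: "t \<in> {0..l}" "tangent \<Gamma> l t \<noteq> tangent \<Gamma> l 0" by auto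
  have l: "0 < l" and T1: "\<And>t. t \<in> {0..l} \<Longrightarrow> norm (tangent \<Gamma> l t) = 1"
    using emb by (auto simp: embedded_arclength_curve_def)
  obtain \<Gamma>'' where d: "\<And>t. t \<in> {0..l} \<Longrightarrow> (tangent \<Gamma> l has_vector_derivative \<Gamma>'' t) (at t within {0..l})"
    using C2_on_interval_tangent[OF emb] by blast
  define g where "g = (\<lambda>t. tangent \<Gamma> l 0 \<bullet> tangent \<Gamma> l t)"
  have "continuous_on {0..l} (tangent \<Gamma> l)"
    using d by (meson continuous_on_eq_continuous_within has_vector_derivative_continuous)
  then have cont: "continuous_on {0..l} g"
    unfolding g_def by (intro continuous_intros)
  have g0: "g 0 = 1" using T1[of 0] l by (simp add: g_def norm_eq_1)
  have abs_g: "\<bar>g s\<bar> \<le> 1" if "s \<in> {0..l}" for s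
    using Cauchy_Schwarz_ineq2[of "tangent \<Gamma> l 0" "tangent \<Gamma> l s"] T1[OF that] T1[of 0] l by (simp add: g_def)
  have "g t \<noteq> 1"
  proof
    assume "g t = 1"
    then have "norm (tangent \<Gamma> l t - tangent \<Gamma> l 0) = 0"
      using T1[OF t(1)] T1[of 0] l
      by (simp add: norm_eq_sqrt_inner inner_diff_left inner_diff_right g_def inner_commute)
    then show False using t(2) by simp
  qed
  then have gt: "g t < 1" using abs_g[OF t(1)] by simp
  \<comment> \<open>The value \<open>g t\<close> may be \<open>- 1\<close>, in which case the normal
    planes at \<open>0\<close> and \<open>t\<close> are parallel. The intermediate value theorem
    supplies a parameter where \<open>g\<close> is \<open>max 0 (g t)\<close>, a number in
    \<open>[0, 1)\<close>.\<close>
  have "\<exists>s. 0 \<le> s \<and> s \<le> t \<and> g s = max 0 (g t)"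
    using g0 gt t(1) cont by (intro IVT2') (auto intro: continuous_on_subset)
  then obtain s where s: "s \<in> {0..l}" "g s = max 0 (g t)" using t(1) by fastforce
  then have "\<bar>g s\<bar> < 1" using gt by auto
  then show ?thesis
    using not_simple_tube_if_not_parallel[of 0 l s \<Gamma>] T1[OF s(1)] T1[of 0] l s(1) bounded
    unfolding g_def by (metis atLeastAtMost_iff less_eq_real_def)
next
  case True
  then show ?thesis by (intro straight) blast
qed

text \<open>
  Points too far from the boundary image are branch points by the previous lemma; they form an
  open set, on which \<open>X\<close> would be locally constant.
\<close>

lemma image_near_boundary_image:
  fixes X :: "real^2 \<Rightarrow> real^3"
  assumes harm: "harmonic_on X (ball 0 1)" and conf: "conformal_on X (ball 0 1)"
    and cont: "continuous_on (cball 0 1) X" and "0 < \<epsilon>"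
    and energy: "dirichlet_energy X \<le> ennreal \<alpha>" "0 \<le> \<alpha>" "\<alpha> < pi * \<epsilon>\<^sup>2 / 256"
    and z: "z \<in> cball 0 1"
  shows "\<exists>z'\<in>sphere 0 1. norm (X z - X z') \<le> \<epsilon>"
proof -
  define S where "S = X ` sphere 0 1"
  define d where "d = (\<lambda>z. infdist (X z) S)"
  have "compact S"
    unfolding S_def by (intro compact_continuous_image continuous_on_subset[OF cont]) auto
  moreover have "S \<noteq> {}" by (simp add: S_def)
  ultimately obtain y where y: "y \<in> S" "d z = dist (X z) y"
    using infdist_attains_inf[of S "X z"] by (auto simp: d_def compact_imp_closed)
  have d_cont: "continuous_on (cball 0 1) d"
    unfolding d_def by (intro continuous_intros cont)
  have "d z \<le> \<epsilon>"
  proof (rule ccontr)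
    assume "\<not> d z \<le> \<epsilon>"
    \<comment> \<open>As \<open>\<eta>\<close> is half the excess, the maximum point
      \<open>w\<close> of the perturbed function still has \<open>d w > \<epsilon>\<close>. The
      perturbation makes local constancy of \<open>X\<close> contradictory at once: with
      \<open>d\<close> constant near \<open>w\<close>, the function \<open>\<eta> * |y|^2\<close>
      would have a local maximum there.\<close>
    define \<eta> where "\<eta> = (d z - \<epsilon>) / 2"
    have \<eta>: "0 < \<eta>" using \<open>\<not> d z \<le> \<epsilon>\<close> by (simp add: \<eta>_def)
    have "continuous_on (cball 0 1) (\<lambda>z. d z + \<eta> * (norm z)\<^sup>2)"
      by (intro continuous_intros d_cont)
    then obtain w where w: "w \<in> cball 0 1"
      "\<And>y. y \<in> cball 0 1 \<Longrightarrow> d y + \<eta> * (norm y)\<^sup>2 \<le> d w + \<eta> * (norm w)\<^sup>2"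
      using continuous_attains_sup[of "cball 0 1" "\<lambda>z. d z + \<eta> * (norm z)\<^sup>2"] by auto
    have "(norm w)\<^sup>2 \<le> 1" using w(1) by (simp add: power_le_one)
    then have "\<eta> * (norm w)\<^sup>2 \<le> \<eta> * 1" using \<eta> by (intro mult_left_mono) auto
    moreover have "0 \<le> \<eta> * (norm z)\<^sup>2" using \<eta> by simp
    ultimately have dw: "\<epsilon> < d w" using w(2)[OF z] \<eta> by (simp add: \<eta>_def field_simps)
    have "w \<notin> sphere 0 1"
      using dw \<open>0 < \<epsilon>\<close> by (auto simp: d_def S_def)
    then have "w \<in> ball 0 1" using w(1) by auto
    moreover have "open (ball 0 1 \<inter> d -` {\<epsilon><..})"
      by (intro continuous_open_preimage continuous_on_subset[OF d_cont]) auto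
    ultimately obtain e where e: "0 < e" "ball w e \<subseteq> ball 0 1 \<inter> d -` {\<epsilon><..}"
      using dw by (meson IntI greaterThan_iff openE vimageI)
    have "(X has_derivative (\<lambda>h. 0)) (at x within ball w e)" if "x \<in> ball w e" for x
    proof -
      have x: "x \<in> ball 0 1" "\<epsilon> < d x" using e(2) that by auto
      have "\<epsilon> < norm (X z' - X x)" if "z' \<in> sphere 0 1" for z'
        using infdist_le[of "X z'" S "X x"] that x(2) by (auto simp: d_def S_def dist_norm norm_minus_commute)
      then have "partial 1 X x = 0"
        using energy_lower_bound_at_regular_point[OF harm conf cont x(1) _ \<open>0 < \<epsilon>\<close> _ energy(1,2)] energy(3) by force
      moreover from this have "partial 2 X x = 0"
        using conf x(1) unfolding conformal_on_def by (metis norm_eq_zero)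
      moreover have diff: "X differentiable at x"
        using harm x(1) by (auto simp: harmonic_on_def C2_on_open_def differentiable_on_eq_differentiable_at)
      moreover have L: "(X has_derivative frechet_derivative X (at x)) (at x)"
        using diff frechet_derivative_works by blast
      ultimately have "frechet_derivative X (at x) = (\<lambda>h. 0)"
        by (simp add: fun_eq_iff frechet_derivative_real_2)
      then show ?thesis
        using has_derivative_at_withinI[OF L] by simp
    qed
    then obtain c where c: "\<And>x. x \<in> ball w e \<Longrightarrow> X x = c"
      using has_derivative_zero_constant[of "ball w e" X] by auto
    then have d_const: "d y = d w" if "y \<in> ball w e" for y
      using that e(1) by (simp add: d_def)
    have "\<eta> * (norm y)\<^sup>2 \<le> \<eta> * (norm w)\<^sup>2" if "y \<in> ball w e" for y
      using w(2)[of y] d_const[OF that] e(2) that by force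
    then show False
      using laplacian_nonpos_at_local_max[OF harm e(1), of w "\<lambda>y. \<eta> * (norm y)\<^sup>2" 0 0 0 0 0 0 \<eta>] e(2) \<eta>
      by force
  qed
  with y show ?thesis by (auto simp: S_def dist_norm)
qed

section \<open>The surface stays in the tube\<close>

text \<open>A perturbation \<open>\<epsilon> * |y|^2\<close> of at most half the excess keeps the
  maximum off the circle, and its positive Laplacian excludes a maximum in the open disc.\<close>

lemma harmonic_inner_le_boundary_bound:
  fixes X :: "real^'n::finite \<Rightarrow> 'b::real_inner"
  assumes harm: "harmonic_on X (ball 0 1)" and cont: "continuous_on (cball 0 1) X"
    and bound: "\<And>y. y \<in> sphere 0 1 \<Longrightarrow> X y \<bullet> v \<le> b" and z: "z \<in> cball 0 1"
  shows "X z \<bullet> v \<le> b"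
proof (rule ccontr)
  assume "\<not> X z \<bullet> v \<le> b"
  define \<epsilon> where "\<epsilon> = (X z \<bullet> v - b) / 2"
  have \<epsilon>: "0 < \<epsilon>" using \<open>\<not> X z \<bullet> v \<le> b\<close> by (simp add: \<epsilon>_def)
  define g where "g = (\<lambda>y. X y \<bullet> v + \<epsilon> * (norm y)\<^sup>2)"
  have "continuous_on (cball 0 1) g"
    unfolding g_def by (intro continuous_intros cont)
  then obtain w where w: "w \<in> cball 0 1" "\<And>y. y \<in> cball 0 1 \<Longrightarrow> g y \<le> g w"
    using continuous_attains_sup[of "cball 0 1" g] by auto
  have "w \<notin> sphere 0 1"
  proof
    assume "w \<in> sphere 0 1"
    then have "g w \<le> b + \<epsilon>" using bound[of w] by (simp add: g_def)
    moreover have "X z \<bullet> v \<le> g z" using \<epsilon> by (simp add: g_def)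
    ultimately show False using w(2)[OF z] \<epsilon> by (simp add: \<epsilon>_def field_simps)
  qed
  then have "w \<in> ball 0 1" using w(1) by auto
  then obtain e where e: "0 < e" "ball w e \<subseteq> ball 0 1" by (meson open_ball openE)
  then have "g y \<le> g w" if "y \<in> ball w e" for y using w(2) that by force
  then show False
    using laplacian_nonpos_at_local_max[OF harm e, of g 0 0 0 0 0 v \<epsilon>] \<epsilon> by (simp add: g_def mult_le_0_iff)
qed

text \<open>A hyperplane separating a point of the surface from \<open>S\<close> would give a linear
  function of \<open>X\<close> that violates the maximum principle.\<close>

lemma harmonic_image_subset_convex:
  fixes X :: "real^'n::finite \<Rightarrow> 'b::euclidean_space"
  assumes "harmonic_on X (ball 0 1)" "continuous_on (cball 0 1) X"
    and S: "convex S" "closed S" "X ` sphere 0 1 \<subseteq> S"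
  shows "X ` cball 0 1 \<subseteq> S"
proof (rule ccontr)
  assume "\<not> X ` cball 0 1 \<subseteq> S"
  then obtain z where z: "z \<in> cball 0 1" "X z \<notin> S" by blast
  then obtain a b where ab: "a \<bullet> X z < b" "\<And>x. x \<in> S \<Longrightarrow> b < a \<bullet> x"
    using separating_hyperplane_closed_point[OF S(1,2)] by metis
  have "X y \<bullet> (- a) \<le> - b" if "y \<in> sphere 0 1" for y
    using ab(2)[of "X y"] S(3) that by (simp add: image_subset_iff inner_commute[of a "X y"])
  then have "X z \<bullet> (- a) \<le> - b"
    using harmonic_inner_le_boundary_bound[OF assms(1,2) _ z(1)] by blast
  with ab(1) show False by (simp add: inner_commute[of a "X z"])
qed

text \<open>A straight curve is a segment, and its tube is a solid cylinder: up to translation, the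
  preimage of a ball under the projection \<open>P\<close> along \<open>T\<close>, cut by the slab
  between the end planes.\<close>

lemma
  assumes emb: "embedded_arclength_curve \<Gamma> l"
    and straight: "\<And>t. t \<in> {0..l} \<Longrightarrow> tangent \<Gamma> l t = tangent \<Gamma> l 0"
  shows convex_straight_tubular_nbhd: "convex (tubular_nbhd \<Gamma> l r)"
    and closed_straight_tubular_nbhd: "closed (tubular_nbhd \<Gamma> l r)"
proof -
  define T where "T = tangent \<Gamma> l 0"
  have l: "0 < l" and T1: "T \<bullet> T = 1"
    using emb by (auto simp: embedded_arclength_curve_def T_def norm_eq_1)
  obtain \<Gamma>'' where d: "\<And>t. t \<in> {0..l} \<Longrightarrow> (\<Gamma> has_vector_derivative tangent \<Gamma> l t) (at t within {0..l})"
    using C2_on_interval_tangent[OF emb] by blast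
  have "((\<lambda>t. \<Gamma> t - t *\<^sub>R T) has_derivative (\<lambda>h. 0)) (at t within {0..l})" if "t \<in> {0..l}" for t
    using d[OF that] straight[OF that] unfolding has_vector_derivative_def T_def
    by (auto intro!: derivative_eq_intros)
  then obtain c where c: "\<And>t. t \<in> {0..l} \<Longrightarrow> \<Gamma> t - t *\<^sub>R T = c"
    using has_derivative_zero_constant[of "{0..l}" "\<lambda>t. \<Gamma> t - t *\<^sub>R T"] by auto
  then have \<Gamma>: "\<Gamma> t = c + t *\<^sub>R T" if "t \<in> {0..l}" for t
    using that by (metis diff_add_cancel)
  define P where "P = (\<lambda>q. q - (q \<bullet> T) *\<^sub>R T)"
  define B where "B = P -` cball 0 r \<inter> ({q. T \<bullet> q \<ge> 0} \<inter> {q. T \<bullet> q \<le> l})"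
  have disc: "c + q \<in> normal_disc \<Gamma> l r t \<longleftrightarrow> norm (P q) \<le> r \<and> q \<bullet> T = t" if "t \<in> {0..l}" for q t
    using straight[OF that] T1 by (auto simp: normal_disc_def \<Gamma>[OF that] P_def dist_norm inner_diff_left algebra_simps simp flip: T_def)
  have "p \<in> tubular_nbhd \<Gamma> l r \<longleftrightarrow> p - c \<in> B" for p
    using disc[of _ "p - c"] by (auto simp: tubular_nbhd_def B_def inner_commute)
  then have tube: "tubular_nbhd \<Gamma> l r = (+) c ` B"
    by (force simp: image_iff)
  have P: "linear P"
    by (intro linearI) (auto simp: P_def algebra_simps)
  have "convex B"
    unfolding B_def using P
    by (intro convex_Int convex_linear_vimage convex_halfspace_ge convex_halfspace_le) auto
  then show "convex (tubular_nbhd \<Gamma> l r)" unfolding tube by (rule convex_translation)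
  have "closed B"
    unfolding B_def using P
    by (intro closed_Int closed_vimage closed_halfspace_ge closed_halfspace_le linear_continuous_on[OF linear_linear[THEN iffD2]]
        linear_continuous_on) (auto simp: linear_linear)
  then show "closed (tubular_nbhd \<Gamma> l r)" unfolding tube by (rule closed_translation)
qed

text \<open>With \<open>c\<close> the tangential component of the displacement from a nearest point
  at parameter \<open>t\<close>, testing the first order condition at both ends shows that the
  displacement is normal to the curve unless \<open>t\<close> is an end.\<close>

lemma eq_endpoint_if_mult_nonpos:
  fixes c t l :: real
  assumes "c \<noteq> 0" "c * (0 - t) \<le> 0" "c * (l - t) \<le> 0" "t \<in> {0..l}"
  shows "t = 0 \<or> t = l"
  using assms by (auto simp: mult_le_0_iff zero_le_mult_iff)

section \<open>Maximum principles for the distance to the curve and for the heights over its end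
  planes\<close>

context arclength_bounds begin

lemma obtain_nearest_point:
  obtains t where "t \<in> {0..l}" "infdist p (\<Gamma> ` {0..l}) = dist p (\<Gamma> t)"
    "\<And>s. s \<in> {0..l} \<Longrightarrow> ((p - \<Gamma> t) \<bullet> tangent \<Gamma> l t) * (s - t) \<le> 0"
proof -
  have "closed (\<Gamma> ` {0..l})" "\<Gamma> ` {0..l} \<noteq> {}"
    using l_pos by (auto intro!: compact_imp_closed compact_continuous_image continuous)
  then obtain q where "q \<in> \<Gamma> ` {0..l}" "infdist p (\<Gamma> ` {0..l}) = dist p q"
    by (rule infdist_attains_inf)
  then obtain t where t: "t \<in> {0..l}" "infdist p (\<Gamma> ` {0..l}) = dist p (\<Gamma> t)"
    by blast
  then have "dist p (\<Gamma> t) \<le> dist p (\<Gamma> s)" if "s \<in> {0..l}" for s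
    using infdist_le[of "\<Gamma> s" "\<Gamma> ` {0..l}" p] that by simp
  then show ?thesis using that t nearest_point_first_order[OF t(1)] by blast
qed

lemma infdist_curve_le_boundary_bound:
  assumes harm: "harmonic_on X (ball 0 1)" and conf: "conformal_on X (ball 0 1)"
    and cont: "continuous_on (cball 0 1) X"
    and near: "\<And>y. y \<in> cball 0 1 \<Longrightarrow> infdist (X y) (\<Gamma> ` {0..l}) < \<rho>"
    and "0 \<le> r" and bound: "\<And>y. y \<in> sphere 0 1 \<Longrightarrow> infdist (X y) (\<Gamma> ` {0..l}) \<le> r"
    and z: "z \<in> cball 0 1"
  shows "infdist (X z) (\<Gamma> ` {0..l}) \<le> r"
proof (rule ccontr)
  define d where "d = (\<lambda>z. infdist (X z) (\<Gamma> ` {0..l}))"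
  assume "\<not> infdist (X z) (\<Gamma> ` {0..l}) \<le> r"
  then have dz: "r\<^sup>2 < (d z)\<^sup>2"
    using \<open>0 \<le> r\<close> by (simp add: d_def power_strict_mono)
  define \<epsilon> where "\<epsilon> = ((d z)\<^sup>2 - r\<^sup>2) / 2"
  have \<epsilon>: "0 < \<epsilon>" using dz by (simp add: \<epsilon>_def)
  have "continuous_on (cball 0 1) (\<lambda>y. (d y)\<^sup>2 + \<epsilon> * (norm y)\<^sup>2)"
    unfolding d_def by (intro continuous_intros cont)
  then obtain w where w: "w \<in> cball 0 1"
    "\<And>y. y \<in> cball 0 1 \<Longrightarrow> (d y)\<^sup>2 + \<epsilon> * (norm y)\<^sup>2 \<le> (d w)\<^sup>2 + \<epsilon> * (norm w)\<^sup>2"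
    using continuous_attains_sup[of "cball 0 1" "\<lambda>y. (d y)\<^sup>2 + \<epsilon> * (norm y)\<^sup>2"] by auto
  have "w \<notin> sphere 0 1"
  proof
    assume ws: "w \<in> sphere 0 1"
    then have "(d w)\<^sup>2 \<le> r\<^sup>2" using bound[OF ws] by (simp add: d_def infdist_nonneg power_mono)
    moreover have "0 \<le> \<epsilon> * (norm z)\<^sup>2" using \<epsilon> by simp
    ultimately show False using w(2)[OF z] ws \<epsilon> by (simp add: \<epsilon>_def field_simps)
  qed
  then have wb: "w \<in> ball 0 1" using w(1) by auto
  obtain t0 where t0: "t0 \<in> {0..l}" "d w = dist (X w) (\<Gamma> t0)"
    "\<And>s. s \<in> {0..l} \<Longrightarrow> ((X w - \<Gamma> t0) \<bullet> tangent \<Gamma> l t0) * (s - t0) \<le> 0"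
    using obtain_nearest_point[of "X w"] by (auto simp: d_def)
  define T where "T = tangent \<Gamma> l t0"
  have "open (ball 0 1 \<inter> (\<lambda>y. norm (X y - \<Gamma> t0)) -` {..<\<rho>})"
    by (intro continuous_open_preimage continuous_intros continuous_on_subset[OF cont]) auto
  moreover have "w \<in> ball 0 1 \<inter> (\<lambda>y. norm (X y - \<Gamma> t0)) -` {..<\<rho>}"
    using wb near[OF w(1)] t0(2) by (simp add: d_def dist_norm)
  ultimately obtain e where e: "0 < e" "ball w e \<subseteq> ball 0 1 \<inter> (\<lambda>y. norm (X y - \<Gamma> t0)) -` {..<\<rho>}"
    by (meson openE)
  \<comment> \<open>The barrier is based at \<open>X w\<close> with \<open>t0\<close> frozen. It
    equals the squared distance at \<open>w\<close> and stays below it nearby, so the maximum at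
    \<open>w\<close> passes to the smooth function \<open>g\<close>, wherever the nearest points of
    the other \<open>X y\<close> lie.\<close>
  define g where "g = (\<lambda>y. 1 * (norm (X y - \<Gamma> t0))\<^sup>2 + (- 4/3) * ((X y - X w) \<bullet> T)\<^sup>2 + X y \<bullet> 0 + \<epsilon> * (norm y)\<^sup>2)"
  have "g y \<le> g w" if y: "y \<in> ball w e" for y
  proof -
    obtain t where t: "t \<in> {0..l}" "d y = dist (X y) (\<Gamma> t)"
      using obtain_nearest_point[of "X y"] by (auto simp: d_def)
    have "norm (X y - \<Gamma> t0) \<le> \<rho>" using e(2) y by auto
    then have "(norm (X y - \<Gamma> t0))\<^sup>2 - 4/3 * ((X y - X w) \<bullet> T)\<^sup>2 \<le> (d y)\<^sup>2"
      using squared_distance_lower_barrier[OF t0(1) t(1) t0(3)[OF t(1)]] by (simp add: T_def t(2) dist_norm)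
    then have "g y \<le> (d y)\<^sup>2 + \<epsilon> * (norm y)\<^sup>2" by (simp add: g_def)
    also have "\<dots> \<le> (d w)\<^sup>2 + \<epsilon> * (norm w)\<^sup>2" using w(2)[of y] e(2) y by force
    also have "\<dots> = g w" by (simp add: g_def t0(2) dist_norm)
    finally show ?thesis .
  qed
  then have max: "2 * 1 * (\<Sum>i\<in>UNIV. (norm (partial i X w))\<^sup>2) + 2 * (- 4/3) * (\<Sum>i\<in>UNIV. (partial i X w \<bullet> T)\<^sup>2)
           + 2 * \<epsilon> * real CARD(2) \<le> 0"
    using e(2) by (intro laplacian_nonpos_at_local_max[OF harm e(1), of w g 1 "\<Gamma> t0" "- 4/3" "X w" T 0 \<epsilon>])
      (auto simp: g_def)
  define P S where "P = (norm (partial 1 X w))\<^sup>2" and "S = (partial 1 X w \<bullet> T)\<^sup>2 + (partial 2 X w \<bullet> T)\<^sup>2"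
  have "S \<le> P"
    using inner_orthogonal_pair_le[of "partial 1 X w" "partial 2 X w" T] conf wb norm_tangent[OF t0(1)]
    by (simp add: conformal_on_def T_def S_def P_def)
  moreover have "(norm (partial 2 X w))\<^sup>2 = P"
    using conf wb by (simp add: conformal_on_def P_def)
  \<comment> \<open>Because \<open>S \<le> P\<close>, the left side is at least
    \<open>4/3 * P + 4 * \<epsilon>\<close>, which is positive.\<close>
  then have "4 * P - 8/3 * S + 4 * \<epsilon> \<le> 0"
    using max by (simp add: sum_2 P_def S_def)
  moreover have "0 \<le> P" by (simp add: P_def)
  ultimately show False using \<epsilon> by linarith
qed

text \<open>A point within distance \<open>r\<close> of the curve but outside the tube lies in a
  cap: its nearest point is an end of the curve and the displacement from there is not normal. Its
  height \<open>u\<close> over the end plane, oriented towards the curve, is negative. Perturbed by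
  a multiple of \<open>|y|^2\<close>, the height would attain an interior minimum on the part of the
  surface near this end, which harmonicity excludes.\<close>

lemma image_subset_tubular_nbhd:
  fixes X :: "real^'n::finite \<Rightarrow> real^3"
  assumes harm: "harmonic_on X (ball 0 1)" and cont: "continuous_on (cball 0 1) X"
    and near: "\<And>y. y \<in> cball 0 1 \<Longrightarrow> infdist (X y) (\<Gamma> ` {0..l}) \<le> r" and r: "r \<le> \<rho> / 2"
    and boundary: "X ` sphere 0 1 \<subseteq> tubular_nbhd \<Gamma> l r"
  shows "X ` cball 0 1 \<subseteq> tubular_nbhd \<Gamma> l r"
proof (rule image_subsetI, rule ccontr)
  fix z assume z: "z \<in> cball 0 1" "X z \<notin> tubular_nbhd \<Gamma> l r"
  obtain t0 where t0: "t0 \<in> {0..l}" "infdist (X z) (\<Gamma> ` {0..l}) = dist (X z) (\<Gamma> t0)"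
    "\<And>s. s \<in> {0..l} \<Longrightarrow> ((X z - \<Gamma> t0) \<bullet> tangent \<Gamma> l t0) * (s - t0) \<le> 0"
    using obtain_nearest_point[of "X z"] by metis
  define T where "T = tangent \<Gamma> l t0"
  define c where "c = (X z - \<Gamma> t0) \<bullet> T"
  have c: "c \<noteq> 0"
    using z(2) t0(1,2) near[OF z(1)] by (auto simp: tubular_nbhd_def normal_disc_def c_def T_def)
  define \<sigma> where "\<sigma> = - sgn c"
  have \<sigma>: "\<bar>\<sigma>\<bar> = 1" "0 \<le> \<sigma> * (t - t0)" if "t \<in> {0..l}" for t
    using c t0(3)[OF that] by (auto simp: \<sigma>_def c_def T_def sgn_if mult_le_0_iff)
  define u where "u = (\<lambda>y. \<sigma> * ((X y - \<Gamma> t0) \<bullet> T))"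
  have uz: "u z < 0"
    using c by (auto simp: u_def \<sigma>_def sgn_if simp flip: c_def)
  \<comment> \<open>A gap: surface points of negative height closer than \<open>\<rho>\<close> to
    the end point are already within \<open>\<rho> / 2\<close> of it, and they do not come from the
    circle. Hence the minimum over the set \<open>K\<close> below is a local minimum in the open
    disc.\<close>
  have negative: "norm (X y - \<Gamma> t0) \<le> \<rho> / 2 \<and> y \<notin> sphere 0 1"
    if y: "y \<in> cball 0 1" "norm (X y - \<Gamma> t0) < \<rho>" "u y < 0" for y
  proof
    show "y \<notin> sphere 0 1"
    proof
      assume "y \<in> sphere 0 1"
      then obtain t where t: "t \<in> {0..l}" "X y \<in> normal_disc \<Gamma> l r t"
        using boundary unfolding tubular_nbhd_def by blast
      then show False
        using inner_tangent_end_nonneg[OF t0(1) t(1) \<sigma>[OF t(1)], of "X y"] y r \<rho>_pos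
        by (simp add: normal_disc_def u_def T_def dist_norm)
    qed
    obtain t where t: "t \<in> {0..l}" "infdist (X y) (\<Gamma> ` {0..l}) = dist (X y) (\<Gamma> t)"
      "\<And>s. s \<in> {0..l} \<Longrightarrow> ((X y - \<Gamma> t) \<bullet> tangent \<Gamma> l t) * (s - t) \<le> 0"
      using obtain_nearest_point[of "X y"] by metis
    have yt: "norm (X y - \<Gamma> t) \<le> \<rho> / 2"
      using near[OF y(1)] t(2) r by (simp add: dist_norm)
    have "(X y - \<Gamma> t) \<bullet> tangent \<Gamma> l t \<noteq> 0"
      using inner_tangent_end_nonneg[OF t0(1) t(1) \<sigma>[OF t(1)], of "X y"] y yt \<rho>_pos
      by (auto simp: u_def T_def)
    then have t_end: "t = 0 \<or> t = l"
      using eq_endpoint_if_mult_nonpos[OF _ t(3) t(3) t(1)] l_pos by simp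
    have t0_end: "t0 = 0 \<or> t0 = l"
      using eq_endpoint_if_mult_nonpos[OF c t0(3)[folded T_def, folded c_def] t0(3)[folded T_def, folded c_def] t0(1)] l_pos by simp
    have "norm (\<Gamma> t - \<Gamma> t0) < 2 * \<rho>"
      using norm_triangle_ineq4[of "X y - \<Gamma> t0" "X y - \<Gamma> t"] yt y(2) \<rho>_pos by simp
    then have "16 * (\<kappa> * \<bar>t - t0\<bar>) \<le> 1" using chord_arc[OF t0(1) t(1)] by simp
    then have "\<bar>t - t0\<bar> \<noteq> l" using \<kappa>l by auto
    then have "t = t0" using t_end t0_end l_pos by auto
    then show "norm (X y - \<Gamma> t0) \<le> \<rho> / 2" using yt by simp
  qed
  \<comment> \<open>With \<open>u z = - 2 * \<epsilon>\<close> the perturbed minimum is at most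
    \<open>- 2 * \<epsilon>\<close>, whereas points with \<open>u \<ge> 0\<close> have perturbed
    value at least \<open>- \<epsilon>\<close>. So the minimum has negative height, and nearby
    points of nonnegative height cannot undercut it.\<close>
  define \<epsilon> where "\<epsilon> = - u z / 2"
  have \<epsilon>: "0 < \<epsilon>" "u z = - 2 * \<epsilon>" using uz by (simp_all add: \<epsilon>_def)
  define K where "K = {y \<in> cball 0 1. norm (X y - \<Gamma> t0) \<le> \<rho> / 2}"
  have "closed K"
    unfolding K_def by (intro continuous_on_closed_Collect_le continuous_intros cont closed_cball)
  moreover have K_sub: "K \<subseteq> cball 0 1" by (auto simp: K_def)
  ultimately have "compact K"
    by (meson bounded_cball bounded_subset compact_eq_bounded_closed)
  moreover have zK: "z \<in> K"
    using z(1) near[OF z(1)] t0(2) r by (simp add: K_def dist_norm)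
  moreover have "continuous_on K (\<lambda>y. u y - \<epsilon> * (norm y)\<^sup>2)"
    unfolding u_def by (intro continuous_intros continuous_on_subset[OF cont K_sub])
  ultimately obtain w where w: "w \<in> K"
    "\<And>y. y \<in> K \<Longrightarrow> u w - \<epsilon> * (norm w)\<^sup>2 \<le> u y - \<epsilon> * (norm y)\<^sup>2"
    using continuous_attains_inf[of K "\<lambda>y. u y - \<epsilon> * (norm y)\<^sup>2"] by auto
  have norm_le: "\<epsilon> * (norm y)\<^sup>2 \<le> \<epsilon>" if "y \<in> cball 0 1" for y :: "real^'n"
    using that \<epsilon> by (simp add: power_le_one)
  have w_le: "u w - \<epsilon> * (norm w)\<^sup>2 \<le> u z"
  proof -
    have "0 \<le> \<epsilon> * (norm z)\<^sup>2" using \<epsilon> by simp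
    then show ?thesis using w(2)[OF zK] by linarith
  qed
  have w_cball: "w \<in> cball 0 1" using w(1) K_sub by auto
  have "u w < 0" using w_le norm_le[OF w_cball] \<epsilon> by linarith
  moreover have w_near: "norm (X w - \<Gamma> t0) < \<rho>" using w(1) \<rho>_pos by (simp add: K_def)
  ultimately have wb: "w \<in> ball 0 1" using negative[OF w_cball] w_cball by auto
  have "open (ball 0 1 \<inter> (\<lambda>y. norm (X y - \<Gamma> t0)) -` {..<\<rho>})"
    by (intro continuous_open_preimage continuous_intros continuous_on_subset[OF cont]) auto
  then obtain e where e: "0 < e" "ball w e \<subseteq> ball 0 1 \<inter> (\<lambda>y. norm (X y - \<Gamma> t0)) -` {..<\<rho>}"
    using wb w_near by (meson IntI lessThan_iff openE vimageI)
  define g where "g = (\<lambda>y. X y \<bullet> (- \<sigma> *\<^sub>R T) + \<epsilon> * (norm y)\<^sup>2)"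
  have g: "g y = - (u y - \<epsilon> * (norm y)\<^sup>2) - \<sigma> * (\<Gamma> t0 \<bullet> T)" for y
    by (simp add: g_def u_def algebra_simps)
  have "g y \<le> g w" if y: "y \<in> ball w e" for y
  proof -
    have y': "y \<in> cball 0 1" "norm (X y - \<Gamma> t0) < \<rho>" using e(2) y by auto
    have "u w - \<epsilon> * (norm w)\<^sup>2 \<le> u y - \<epsilon> * (norm y)\<^sup>2"
    proof (cases "u y < 0")
      case True
      then show ?thesis using negative[OF y'] y' w(2)[of y] by (simp add: K_def)
    next
      case False
      then show ?thesis using w_le norm_le[OF y'(1)] \<epsilon> by linarith
    qed
    then show ?thesis by (simp add: g)
  qed
  moreover have "ball w e \<subseteq> ball 0 1" using e(2) by blast
  ultimately show False
    using laplacian_nonpos_at_local_max[OF harm e(1), of w g 0 0 0 0 0 "- \<sigma> *\<^sub>R T" \<epsilon>] \<epsilon>(1)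
    by (simp add: g_def mult_le_0_iff)
qed

end

theorem lemma3p4:
  fixes \<Gamma> :: "real \<Rightarrow> real^3" and l :: real
  assumes "embedded_arclength_curve \<Gamma> l"
  shows "\<exists>C1 C2 :: real. \<exists>e :: real \<Rightarrow> real.
    0 < C1 \<and> 0 < C2 \<and> e \<in> o[at_right 0](\<lambda>\<alpha>. \<alpha> powr (2/3)) \<and>
    (\<forall>(X :: real^2 \<Rightarrow> real^3) (r1 :: real) (r2 :: real) (\<alpha> :: real).
       0 < \<alpha> \<longrightarrow> 0 < r1 \<longrightarrow>
       r2 = C1 * r1 + C2 * \<alpha> powr (2/3) + e \<alpha> \<longrightarrow>
       simple_tube \<Gamma> l r1 \<longrightarrow> simple_tube \<Gamma> l r2 \<longrightarrow>
       H1_on X (ball 0 1) \<longrightarrow> continuous_on (cball 0 1) X \<longrightarrow>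
       harmonic_on X (ball 0 1) \<longrightarrow> conformal_on X (ball 0 1) \<longrightarrow>
       X ` sphere 0 1 \<subseteq> tubular_nbhd \<Gamma> l r1 \<longrightarrow>
       dirichlet_energy X \<le> ennreal \<alpha> \<longrightarrow>
       X ` cball 0 1 \<subseteq> tubular_nbhd \<Gamma> l r2)"
proof -
  have tube_mono: "tubular_nbhd \<Gamma> l r1 \<subseteq> tubular_nbhd \<Gamma> l r2" if "r1 \<le> r2" for r1 r2
    using that by (force simp: tubular_nbhd_def normal_disc_def)
  from assms show ?thesis
  proof (cases rule: straight_or_tube_radii_bounded)
    case straight
    have "X ` cball 0 1 \<subseteq> tubular_nbhd \<Gamma> l (1 * r1 + 1 * \<alpha> powr (2/3) + 0)"
      if "harmonic_on X (ball 0 1)" "continuous_on (cball 0 1) X" "X ` sphere 0 1 \<subseteq> tubular_nbhd \<Gamma> l r1"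
      for X :: "real^2 \<Rightarrow> real^3" and r1 \<alpha>
      using harmonic_image_subset_convex[OF that(1,2) convex_straight_tubular_nbhd[OF assms straight]
          closed_straight_tubular_nbhd[OF assms straight] that(3)]
        tube_mono[of r1 "1 * r1 + 1 * \<alpha> powr (2/3) + 0"] by simp
    then show ?thesis
      by (intro exI[of _ 1] exI[of _ "\<lambda>_. 0"]) auto
  next
    case (bounded R)
    obtain \<kappa> \<rho> where "arclength_bounds \<Gamma> l \<kappa> \<rho>" using ex_arclength_bounds[OF assms] by blast
    then interpret arclength_bounds \<Gamma> l \<kappa> \<rho> .
    \<comment> \<open>If \<open>r1 \<ge> \<rho> / 4\<close> then \<open>C1 * r1 > R\<close>, and if
      \<open>\<alpha> \<ge> \<alpha>0\<close> then \<open>e \<alpha> = R\<close>; either way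
      \<open>r2 \<ge> R\<close>, so the tube of radius \<open>r2\<close> is not simple. The
      threshold \<open>\<alpha>0\<close> is the energy that permits a distance
      \<open>\<rho> / 4\<close> from the boundary image, and the growth condition on
      \<open>e\<close> concerns only \<open>\<alpha>\<close> near 0, where \<open>e\<close>
      vanishes.\<close>
    define C1 where "C1 = 1 + 4 * R / \<rho>"
    define \<alpha>0 where "\<alpha>0 = pi * (\<rho> / 4)\<^sup>2 / 256"
    define e where "e = (\<lambda>\<alpha>. if \<alpha> < \<alpha>0 then 0 else R)"
    have C1: "1 \<le> C1" using bounded(1) \<rho>_pos by (simp add: C1_def)
    have "0 < \<alpha>0" using \<rho>_pos by (simp add: \<alpha>0_def)
    then have "\<forall>\<^sub>F \<alpha> in at_right 0. e \<alpha> = 0"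
      by (auto simp: eventually_at_right e_def)
    then have "e \<in> o[at_right 0](\<lambda>\<alpha>. \<alpha> powr (2/3))"
      by (subst landau_o.small.in_cong[of _ "\<lambda>_. 0"]) auto
    moreover have "X ` cball 0 1 \<subseteq> tubular_nbhd \<Gamma> l r2"
      if \<alpha>: "0 < \<alpha>" and r1: "0 < r1" and r2: "r2 = C1 * r1 + 1 * \<alpha> powr (2/3) + e \<alpha>"
        and simple: "simple_tube \<Gamma> l r2" and cont: "continuous_on (cball 0 1) X"
        and harm: "harmonic_on X (ball 0 1)" and conf: "conformal_on X (ball 0 1)"
        and boundary: "X ` sphere 0 1 \<subseteq> tubular_nbhd \<Gamma> l r1" and energy: "dirichlet_energy X \<le> ennreal \<alpha>"
      for X :: "real^2 \<Rightarrow> real^3" and r1 r2 \<alpha>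
    proof -
      have "r2 < R" using bounded(2)[of r2] simple by force
      have "0 \<le> \<alpha> powr (2/3)" "0 \<le> e \<alpha>" using bounded(1) by (auto simp: e_def)
      moreover have "1 * r1 \<le> C1 * r1" using C1 r1 by (intro mult_right_mono) auto
      ultimately have le: "e \<alpha> < R" "C1 * r1 < R" "r1 \<le> r2" using \<open>r2 < R\<close> r1 r2 by linarith+
      then have \<alpha>0: "\<alpha> < \<alpha>0" by (auto simp: e_def split: if_splits)
      have "4 * R / \<rho> * r1 < R" using le(2) r1 by (simp add: C1_def algebra_simps)
      then have r1\<rho>: "r1 < \<rho> / 4" using bounded(1) \<rho>_pos by (simp add: field_simps)
      have bound: "infdist (X y) (\<Gamma> ` {0..l}) \<le> r1" if "y \<in> sphere 0 1" for y
      proof -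
        obtain t where "t \<in> {0..l}" "X y \<in> normal_disc \<Gamma> l r1 t"
          using boundary \<open>y \<in> sphere 0 1\<close> unfolding tubular_nbhd_def by blast
        then show ?thesis using infdist_le[of "\<Gamma> t" "\<Gamma> ` {0..l}" "X y"] by (simp add: normal_disc_def)
      qed
      have near: "infdist (X y) (\<Gamma> ` {0..l}) < \<rho>" if y: "y \<in> cball 0 1" for y
      proof -
        obtain y' where y': "y' \<in> sphere 0 1" "norm (X y - X y') \<le> \<rho> / 4"
          using image_near_boundary_image[OF harm conf cont _ energy _ _ y, of "\<rho> / 4"] \<alpha> \<alpha>0 \<rho>_pos
          by (auto simp: \<alpha>0_def)
        have "infdist (X y) (\<Gamma> ` {0..l}) \<le> infdist (X y') (\<Gamma> ` {0..l}) + dist (X y) (X y')"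
          by (rule infdist_triangle)
        then show ?thesis using bound[OF y'(1)] y'(2) r1\<rho> \<rho>_pos by (simp add: dist_norm)
      qed
      have "X ` cball 0 1 \<subseteq> tubular_nbhd \<Gamma> l r1"
        using infdist_curve_le_boundary_bound[OF harm conf cont near _ bound] r1 r1\<rho> boundary
        by (intro image_subset_tubular_nbhd[OF harm cont]) auto
      then show ?thesis using tube_mono[OF le(3)] by blast
    qed
    ultimately show ?thesis
      using C1 by (intro exI[of _ C1] exI[of _ 1] exI[of _ e]) (auto simp: less_le_trans[OF zero_less_one])
  qed
qed

end
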